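(* Let $p$ be a prime, $f\geq 1$, $q=p^f$, and let $m\geq 0$ be an integer. Let $r=(r_0,\ldots,r_{f-1})$ be a tuple of integers with $r_i\geq m+mq+q$ for all $0\le i\le f-1$. Then the $\mathrm{GL}_2(\mathbb{F}_q)$-representation $V_r/V_r^{(m+1)}$ is decomposable into principal series.
   Context: For a tuple $r=(r_0,\ldots,r_{f-1})$ of non-negative integers, $V_r=\bigotimes_{i=0}^{f-1}(\mathrm{Sym}^{r_i}\mathbb{F}_q^2\circ\mathrm{Fr}^i)$ is the $\mathbb{F}_q$-space of multi-homogeneous polynomials over $\mathbb{F}_q$ in $x_0,y_0,\ldots,x_{f-1},y_{f-1}$, of degree $r_i$ in $(x_i,y_i)$, with $\alpha=\begin{pmatrix}a&b\\c&d\end{pmatrix}\in\mathrm{GL}_2(\mathbb{F}_q)$ acting by $\alpha\cdot\prod_iP_i(x_i,y_i)=\prod_iP_i(a^{p^i}x_i+c^{p^i}y_i,\,b^{p^i}x_i+d^{p^i}y_i)$. The twisted Dickson polynomials are $\theta_i=x_iy_{i-1}^p-y_ix_{i-1}^p$ for $i\in\{0,\ldots,f-1\}$, with the convention that the index $-1$ means $f-1$; each $\theta_i$ is multiplied by $\det(\alpha)^{p^i}$ under $\alpha$. For a polynomial $g$, $\langle g\rangle\subset V_r$ is the subspace of all polynomials in $V_r$ divisible by $g$, and $\langle g_1,\ldots,g_k\rangle=\langle g_1\rangle+\cdots+\langle g_k\rangle$. For $k\ge 0$, $V_r^{(k)}=\langle\theta_0^{k},\theta_1^{k},\ldots,\theta_{f-1}^{k}\rangle$,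 a subrepresentation of $V_r$. A principal series is a representation of $\mathrm{GL}_2(\mathbb{F}_q)$ over $\mathbb{F}_q$ isomorphic to $\mathrm{ind}_{B(\mathbb{F}_q)}^{\mathrm{GL}_2(\mathbb{F}_q)}\chi$ for some character $\chi:B(\mathbb{F}_q)\to\mathbb{F}_q^\times$, where $B(\mathbb{F}_q)$ is the subgroup of upper triangular matrices. A representation is decomposable into principal series if it has a finite filtration by subrepresentations (from $0$ to the whole representation) whose successive sub-quotients are principal series. *)

theory Defs
  imports
    "HOL-Analysis.Finite_Cartesian_Product"
    "HOL-Library.Poly_Mapping"
    "HOL-Algebra.Module"
    "HOL-Algebra.QuotRing"
    "HOL-Algebra.Multiplicative_Group"
    "HOL-Algebra.Algebraic_Closure_Type"
begin

section \<open>Representations of a group over a field\<close>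

text \<open>
  Module records of HOL-Algebra inherit the fields \<open>mult\<close> and \<open>one\<close> of ring records. They play no
  role for modules and are left \<open>undefined\<close> below.
\<close>

record ('k, 'v, 'g) rep = "('k, 'v) module" +
  act :: "'g \<Rightarrow> 'v \<Rightarrow> 'v"

locale representation =
  Group.group G + field K + Module.module K V
  for G :: "('g, 'n) monoid_scheme" and K :: "('k, 'l) ring_scheme"
    and V :: "('k, 'v, 'g, 'm) rep_scheme" +
  assumes act_closed: "\<lbrakk>g \<in> carrier G; v \<in> carrier V\<rbrakk> \<Longrightarrow> act V g v \<in> carrier V"
    and act_add: "\<lbrakk>g \<in> carrier G; v \<in> carrier V; w \<in> carrier V\<rbrakk>
      \<Longrightarrow> act V g (v \<oplus>\<^bsub>V\<^esub> w) = act V g v \<oplus>\<^bsub>V\<^esub> act V g w"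
    and act_smult: "\<lbrakk>g \<in> carrier G; c \<in> carrier K; v \<in> carrier V\<rbrakk>
      \<Longrightarrow> act V g (c \<odot>\<^bsub>V\<^esub> v) = c \<odot>\<^bsub>V\<^esub> act V g v"
    and act_one: "v \<in> carrier V \<Longrightarrow> act V \<one>\<^bsub>G\<^esub> v = v"
    and act_mult: "\<lbrakk>g \<in> carrier G; h \<in> carrier G; v \<in> carrier V\<rbrakk>
      \<Longrightarrow> act V (g \<otimes>\<^bsub>G\<^esub> h) v = act V g (act V h v)"

definition subrepresentation ::
  "('g, 'n) monoid_scheme \<Rightarrow> ('k, 'l) ring_scheme \<Rightarrow> ('k, 'v, 'g, 'm) rep_scheme \<Rightarrow> 'v set \<Rightarrow> bool"
  where "subrepresentation G K V U \<longleftrightarrow>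
    submodule U K V \<and> (\<forall>g\<in>carrier G. \<forall>u\<in>U. act V g u \<in> U)"

definition quotient_rep :: "('k, 'v, 'g, 'm) rep_scheme \<Rightarrow> 'v set \<Rightarrow> ('k, 'v set, 'g) rep"
  where "quotient_rep V U =
    \<lparr>carrier = a_rcosets\<^bsub>V\<^esub> U, monoid.mult = undefined, one = undefined,
     zero = U, add = set_add V,
     module.smult = (\<lambda>c C. \<Union>v\<in>C. U +>\<^bsub>V\<^esub> (c \<odot>\<^bsub>V\<^esub> v)),
     act = (\<lambda>g C. \<Union>v\<in>C. U +>\<^bsub>V\<^esub> act V g v)\<rparr>"

definition rep_isomorphic ::
  "('g, 'n) monoid_scheme \<Rightarrow> ('k, 'l) ring_scheme \<Rightarrow>
    ('k, 'v, 'g, 'm) rep_scheme \<Rightarrow> ('k, 'w, 'g, 'o) rep_scheme \<Rightarrow> bool"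
  where "rep_isomorphic G K V W \<longleftrightarrow>
    (\<exists>h \<in> iso (add_monoid V) (add_monoid W).
      (\<forall>c\<in>carrier K. \<forall>v\<in>carrier V. h (c \<odot>\<^bsub>V\<^esub> v) = c \<odot>\<^bsub>W\<^esub> h v) \<and>
      (\<forall>g\<in>carrier G. \<forall>v\<in>carrier V. h (act V g v) = act W g (h v)))"

text \<open>
  Right translation on functions that are \<open>H\<close>-equivariant on the left. The functions are extensional
  on \<open>carrier G\<close>; only the values of \<open>chi\<close> on \<open>H\<close> matter.
\<close>

definition induced_rep ::
  "('g, 'n) monoid_scheme \<Rightarrow> 'g set \<Rightarrow> ('k, 'l) ring_scheme \<Rightarrow> ('g \<Rightarrow> 'k) \<Rightarrow> ('k, 'g \<Rightarrow> 'k, 'g) rep"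
  where "induced_rep G H K chi =
    \<lparr>carrier = {\<phi> \<in> carrier G \<rightarrow>\<^sub>E carrier K.
       \<forall>b\<in>H. \<forall>g\<in>carrier G. \<phi> (b \<otimes>\<^bsub>G\<^esub> g) = chi b \<otimes>\<^bsub>K\<^esub> \<phi> g},
     monoid.mult = undefined, one = undefined,
     zero = (\<lambda>x\<in>carrier G. \<zero>\<^bsub>K\<^esub>),
     add = (\<lambda>\<phi> \<psi>. \<lambda>x\<in>carrier G. \<phi> x \<oplus>\<^bsub>K\<^esub> \<psi> x),
     module.smult = (\<lambda>c \<phi>. \<lambda>x\<in>carrier G. c \<otimes>\<^bsub>K\<^esub> \<phi> x),
     act = (\<lambda>g \<phi>. \<lambda>x\<in>carrier G. \<phi> (x \<otimes>\<^bsub>G\<^esub> g))\<rparr>"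


section \<open>Principal series\<close>

definition GL2 :: "('k::field ^ 2 ^ 2) monoid"
  where "GL2 = \<lparr>carrier = {A. invertible A}, monoid.mult = (**), one = mat 1\<rparr>"

definition borel_subgroup :: "('k::field ^ 2 ^ 2) set"
  where "borel_subgroup = {A \<in> carrier GL2. A $ 2 $ 1 = 0}"

definition principal_series :: "('k::field, 'v, 'k ^ 2 ^ 2, 'm) rep_scheme \<Rightarrow> bool"
  where "principal_series V \<longleftrightarrow>
    representation GL2 ring_of_type_algebra V \<and>
    (\<exists>chi \<in> hom (GL2\<lparr>carrier := borel_subgroup\<rparr>) (mult_of ring_of_type_algebra).
      rep_isomorphic GL2 ring_of_type_algebra V
        (induced_rep GL2 borel_subgroup ring_of_type_algebra chi))"

definition decomposable_into_principal_series ::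
  "('k::field, 'v, 'k ^ 2 ^ 2, 'm) rep_scheme \<Rightarrow> bool"
  where "decomposable_into_principal_series V \<longleftrightarrow>
    representation GL2 ring_of_type_algebra V \<and>
    (\<exists>(n::nat) F. F 0 = {\<zero>\<^bsub>V\<^esub>} \<and> F n = carrier V \<and>
      (\<forall>i\<le>n. subrepresentation GL2 ring_of_type_algebra V (F i)) \<and>
      (\<forall>i<n. F i \<subseteq> F (Suc i) \<and>
        principal_series (quotient_rep (V\<lparr>carrier := F (Suc i)\<rparr>) (F i))))"


section \<open>Multi-homogeneous polynomials\<close>

text \<open>
  Polynomials live in the polynomial ring in infinitely many variables \<open>Xvar i\<close>, \<open>Yvar i\<close>; membership in
  \<open>V_carrier f r\<close> below forces that only the variables with \<open>i < f\<close> occur.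
\<close>

datatype var = Xvar nat | Yvar nat

type_synonym 'k mpoly = "(var \<Rightarrow>\<^sub>0 nat) \<Rightarrow>\<^sub>0 'k"

definition Const :: "'k::zero \<Rightarrow> 'k mpoly"
  where "Const c = Poly_Mapping.single 0 c"

definition Var :: "var \<Rightarrow> 'k::zero_neq_one mpoly"
  where "Var v = Poly_Mapping.single (Poly_Mapping.single v 1) 1"

definition subst :: "(var \<Rightarrow> 'k mpoly) \<Rightarrow> 'k::comm_ring_1 mpoly \<Rightarrow> 'k mpoly"
  where "subst \<sigma> P =
    (\<Sum>t\<in>Poly_Mapping.keys P.
      Const (Poly_Mapping.lookup P t) *
      (\<Prod>v\<in>Poly_Mapping.keys t. \<sigma> v ^ Poly_Mapping.lookup t v))"

text \<open>
  For \<open>\<alpha> = (a b; c d)\<close> the row vector \<open>(x\<^sub>i, y\<^sub>i)\<close> is replaced by its product with the matrix obtained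
  from \<open>\<alpha>\<close> by raising all entries to the power \<open>p\<^sup>i\<close>, which makes \<open>V_rep\<close> a left representation.
\<close>

fun frob_subst :: "nat \<Rightarrow> 'k::field ^ 2 ^ 2 \<Rightarrow> var \<Rightarrow> 'k mpoly"
  where
    "frob_subst p A (Xvar i) =
      Const ((A $ 1 $ 1) ^ (p ^ i)) * Var (Xvar i) + Const ((A $ 2 $ 1) ^ (p ^ i)) * Var (Yvar i)"
  | "frob_subst p A (Yvar i) =
      Const ((A $ 1 $ 2) ^ (p ^ i)) * Var (Xvar i) + Const ((A $ 2 $ 2) ^ (p ^ i)) * Var (Yvar i)"

definition V_carrier :: "nat \<Rightarrow> (nat \<Rightarrow> nat) \<Rightarrow> 'k::zero mpoly set"
  where "V_carrier f r =
    {P. \<forall>t\<in>Poly_Mapping.keys P. \<forall>i.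
      Poly_Mapping.lookup t (Xvar i) + Poly_Mapping.lookup t (Yvar i) = (if i < f then r i else 0)}"

definition V_rep :: "nat \<Rightarrow> nat \<Rightarrow> (nat \<Rightarrow> nat) \<Rightarrow> ('k::field, 'k mpoly, 'k ^ 2 ^ 2) rep"
  where "V_rep p f r =
    \<lparr>carrier = V_carrier f r, monoid.mult = undefined, one = undefined,
     zero = 0, add = (+), module.smult = (\<lambda>c P. Const c * P),
     act = (\<lambda>A. subst (frob_subst p A))\<rparr>"

text \<open>The index \<open>i - 1\<close> is cyclic modulo \<open>f\<close>; for \<open>f = 1\<close> this is \<open>x\<^sub>0 y\<^sub>0^p - y\<^sub>0 x\<^sub>0^p\<close>.\<close>

definition theta :: "nat \<Rightarrow> nat \<Rightarrow> nat \<Rightarrow> 'k::field mpoly"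
  where "theta p f i =
    (let j = (if i = 0 then f - 1 else i - 1)
     in Var (Xvar i) * Var (Yvar j) ^ p - Var (Yvar i) * Var (Xvar j) ^ p)"

text \<open>
  \<open>multiples f r g\<close> is \<open>\<langle>g\<rangle>\<close>, and \<open>V_sub p f r k\<close> is \<open>V\<^sub>r\<^sup>(\<^sup>k\<^sup>) = \<langle>\<theta>\<^sub>0\<^sup>k\<rangle> + \<dots> + \<langle>\<theta>\<^bsub>f-1\<^esub>\<^sup>k\<rangle>\<close>.
\<close>

definition multiples :: "nat \<Rightarrow> (nat \<Rightarrow> nat) \<Rightarrow> 'k::field mpoly \<Rightarrow> 'k mpoly set"
  where "multiples f r g = {P \<in> V_carrier f r. g dvd P}"

definition V_sub :: "nat \<Rightarrow> nat \<Rightarrow> (nat \<Rightarrow> nat) \<Rightarrow> nat \<Rightarrow> 'k::field mpoly set"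
  where "V_sub p f r k =
    {\<Sum>i<f. u i | u. \<forall>i<f. u i \<in> multiples f r (theta p f i ^ k)}"

end

theory Submission
  imports Defs "HOL-Analysis.Determinants"
begin

text \<open>
  Think of \<open>(x_i : y_i)\<close> as the coordinates on the \<open>i\<close>-th factor of \<open>f\<close> copies of the projective line. The
  equation \<open>\<theta>_i = 0\<close> says that the \<open>i\<close>-th point is the Frobenius image of the preceding one. Going once
  around the cycle, a common zero of all \<open>\<theta>_i\<close> is fixed by the \<open>q\<close>-power map, so the common zeros are
  the \<open>q + 1\<close> rational points, embedded by \<open>(c : d) \<mapsto> (c^{p^i} : d^{p^i})_i\<close>. Since \<open>p\<close>-th powers have zero
  derivative, the \<open>\<theta>_i\<close> are local coordinates at each of these points. Hence \<open>V_r / V_r^{(m+1)}\<close> should look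
  at each rational point like the truncated polynomials in the \<open>\<theta>_i\<close> with all exponents at most \<open>m\<close>,
  and the piece of \<open>\<theta>^e = \<Prod>_i \<theta>_i^{e_i}\<close> should be the space of functions on the rational points, twisted by a
  character: a principal series.

  To turn this into a proof, the exponent vectors \<open>e\<close> are listed in a linear order that extends the
  componentwise one, and the multiples of the \<open>\<theta>^e\<close> are added to \<open>V_r^{(m+1)}\<close> one at a time, largest \<open>e\<close>
  first (\<open>filtration\<close>). The step that adds \<open>\<theta>^e\<close> is analysed by the map which sends \<open>Q\<close> to the function
  on the group whose value at \<open>A\<close> is the coefficient of \<open>\<theta>^e\<close> in the local expansion of \<open>A \<cdot> Q\<close> at the
  point \<open>(0 : 1)\<close>. Three facts make it an isomorphism onto an induced representation.

  First, the coefficient is well defined. The substitution \<open>x_i = \<Sum>_j T_{i-j}^{p^j}\<close>, \<open>y_i = 1\<close>, with the sum taken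
  over one turn of the cycle, sends \<open>\<theta>_i\<close> to \<open>T_i - T_i^q\<close>, which is \<open>T_i\<close> times a unit at the origin
  (\<open>local_subst_theta\<close>). So the coefficient of \<open>T^e\<close> vanishes on all multiples added earlier, and on
  \<open>\<theta>^e P\<close> it is the value of \<open>P\<close> at \<open>(0 : 1)\<close>.

  Second, a \<open>P\<close> that vanishes at all rational points lies in \<open>V^{(1)}\<close> (\<open>vanishing_imp_V_sub\<close>). Modulo the
  \<open>\<theta>_i\<close> a factor \<open>x_{i-1}^p y_i\<close> of a monomial may be replaced by \<open>x_i y_{i-1}^p\<close>, which is a carry in base \<open>p\<close>.
  Repeated carries lead to one of the \<open>q\<close> monomials whose \<open>x\<close>-exponents are base \<open>p\<close> digits, or to
  the pure power of the \<open>x_i\<close>, and the values of these \<open>q + 1\<close> monomials at the rational points are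
  linearly independent, because a nonzero polynomial of degree less than \<open>q\<close> has fewer than \<open>q\<close> roots.

  Third, every function on the rational points is interpolated by a polynomial (\<open>interpolation\<close>).

  The last two facts need degree at least \<open>p\<close> in each pair of variables. They are applied to the
  cofactor of \<open>\<theta>^e\<close>, whose degree is that of \<open>V_r\<close> diminished by at most \<open>m + mp\<close>; this is where the
  lower bound on \<open>r\<close> enters.
\<close>

no_notation fps_nth (infixl \<open>$\<close> 75)

section \<open>Subquotients of representations\<close>

lemma a_r_coset_iff: "x \<in> U +>\<^bsub>V\<^esub> v \<longleftrightarrow> (\<exists>u\<in>U. x = u \<oplus>\<^bsub>V\<^esub> v)"
  by (auto simp: a_r_coset_def')

lemma (in representation) subrep_abelian_subgroup:
  "subrepresentation G K V U \<Longrightarrow> abelian_subgroup U V"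
  by (rule abelian_subgroupI3)
    (auto simp: subrepresentation_def submodule_def additive_subgroup_def M.abelian_group_axioms)

lemma (in representation) subrepresentationI:
  assumes "U \<subseteq> carrier V" "\<zero>\<^bsub>V\<^esub> \<in> U"
    and "\<And>u v. u \<in> U \<Longrightarrow> v \<in> U \<Longrightarrow> u \<oplus>\<^bsub>V\<^esub> v \<in> U"
    and "\<And>c u. c \<in> carrier K \<Longrightarrow> u \<in> U \<Longrightarrow> c \<odot>\<^bsub>V\<^esub> u \<in> U"
    and "\<And>g u. g \<in> carrier G \<Longrightarrow> u \<in> U \<Longrightarrow> act V g u \<in> U"
  shows "subrepresentation G K V U"
proof -
  have "\<ominus>\<^bsub>V\<^esub> u \<in> U" if "u \<in> U" for u
  proof -
    have "(\<ominus>\<^bsub>K\<^esub> \<one>\<^bsub>K\<^esub>) \<odot>\<^bsub>V\<^esub> u = \<ominus>\<^bsub>V\<^esub> u"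
      using that assms(1) smult_l_minus[of "\<one>\<^bsub>K\<^esub>" u] by auto
    then show ?thesis using assms(4)[of "\<ominus>\<^bsub>K\<^esub> \<one>\<^bsub>K\<^esub>" u] that by auto
  qed
  then show ?thesis
    unfolding subrepresentation_def using assms by (auto intro!: submoduleI)
qed

lemma (in representation) subrepD:
  assumes "subrepresentation G K V U"
  shows "U \<subseteq> carrier V" "\<zero>\<^bsub>V\<^esub> \<in> U"
    and "u \<in> U \<Longrightarrow> v \<in> U \<Longrightarrow> u \<oplus>\<^bsub>V\<^esub> v \<in> U"
    and "c \<in> carrier K \<Longrightarrow> u \<in> U \<Longrightarrow> c \<odot>\<^bsub>V\<^esub> u \<in> U"
    and "g \<in> carrier G \<Longrightarrow> u \<in> U \<Longrightarrow> act V g u \<in> U"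
proof -
  interpret S: abelian_subgroup U V by (rule subrep_abelian_subgroup[OF assms])
  show "U \<subseteq> carrier V" "\<zero>\<^bsub>V\<^esub> \<in> U" "u \<in> U \<Longrightarrow> v \<in> U \<Longrightarrow> u \<oplus>\<^bsub>V\<^esub> v \<in> U"
    by (auto simp: S.a_subset)
  show "c \<in> carrier K \<Longrightarrow> u \<in> U \<Longrightarrow> c \<odot>\<^bsub>V\<^esub> u \<in> U"
    and "g \<in> carrier G \<Longrightarrow> u \<in> U \<Longrightarrow> act V g u \<in> U"
    using assms by (auto simp: subrepresentation_def submodule_def submodule_axioms_def)
qed

lemma (in representation) representation_restrict:
  assumes "subrepresentation G K V U"
  shows "representation G K (V\<lparr>carrier := U\<rparr>)"
proof -
  have "submodule U K V" using assms by (simp add: subrepresentation_def)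
  then have "module K (V\<lparr>carrier := U\<rparr>)"
    by (rule submodule.submodule_is_module) (rule module_axioms)
  then interpret R: Module.module K "V\<lparr>carrier := U\<rparr>" .
  show ?thesis
    by unfold_locales
      (use subrepD[OF assms] in \<open>auto simp: subset_iff act_add act_smult act_one act_mult\<close>)
qed

text \<open>
  The operations of \<open>quotient_rep\<close> are unions over all representatives of a coset; for an additive map
  that preserves \<open>U\<close> all members of the union agree.
\<close>

lemma (in representation) coset_image_union:
  assumes U: "subrepresentation G K V U"
    and T: "\<And>v. v \<in> carrier V \<Longrightarrow> T v \<in> carrier V"
      "\<And>u v. u \<in> carrier V \<Longrightarrow> v \<in> carrier V \<Longrightarrow> T (u \<oplus>\<^bsub>V\<^esub> v) = T u \<oplus>\<^bsub>V\<^esub> T v"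
      "\<And>u. u \<in> U \<Longrightarrow> T u \<in> U"
    and v: "v \<in> carrier V"
  shows "(\<Union>w\<in>U +>\<^bsub>V\<^esub> v. U +>\<^bsub>V\<^esub> T w) = U +>\<^bsub>V\<^esub> T v"
proof -
  interpret S: abelian_subgroup U V by (rule subrep_abelian_subgroup[OF U])
  have *: "U +>\<^bsub>V\<^esub> T w = U +>\<^bsub>V\<^esub> T v" if w: "w \<in> U +>\<^bsub>V\<^esub> v" for w
  proof -
    obtain u where u: "u \<in> U" "w = u \<oplus>\<^bsub>V\<^esub> v" using w by (auto simp: a_r_coset_iff)
    have "u \<in> carrier V" using u(1) S.a_subset by auto
    then have "T w = T u \<oplus>\<^bsub>V\<^esub> T v" using u T(2) v by auto
    then have "T w \<in> U +>\<^bsub>V\<^esub> T v" using T(3) u(1) by (auto simp: a_r_coset_iff)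
    then show ?thesis using T(1) v by (metis S.a_repr_independence')
  qed
  have "v \<in> U +>\<^bsub>V\<^esub> v" by (rule S.a_rcos_self[OF v])
  then show ?thesis using * by blast
qed

lemma quotient_rep_simps:
  "carrier (quotient_rep V U) = (\<lambda>v. U +>\<^bsub>V\<^esub> v) ` carrier V"
  "zero (quotient_rep V U) = U"
  "add (quotient_rep V U) = set_add V"
  by (auto simp: quotient_rep_def A_RCOSETS_def')

lemma (in representation) quotient_rep_ops:
  assumes U: "subrepresentation G K V U" and v: "v \<in> carrier V"
  shows "w \<in> carrier V \<Longrightarrow> (U +>\<^bsub>V\<^esub> v) \<oplus>\<^bsub>quotient_rep V U\<^esub> (U +>\<^bsub>V\<^esub> w) = U +>\<^bsub>V\<^esub> (v \<oplus>\<^bsub>V\<^esub> w)"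
    and "c \<in> carrier K \<Longrightarrow> c \<odot>\<^bsub>quotient_rep V U\<^esub> (U +>\<^bsub>V\<^esub> v) = U +>\<^bsub>V\<^esub> (c \<odot>\<^bsub>V\<^esub> v)"
    and "g \<in> carrier G \<Longrightarrow> act (quotient_rep V U) g (U +>\<^bsub>V\<^esub> v) = U +>\<^bsub>V\<^esub> act V g v"
proof -
  interpret S: abelian_subgroup U V by (rule subrep_abelian_subgroup[OF U])
  note D = subrepD[OF U]
  show "w \<in> carrier V \<Longrightarrow> (U +>\<^bsub>V\<^esub> v) \<oplus>\<^bsub>quotient_rep V U\<^esub> (U +>\<^bsub>V\<^esub> w) = U +>\<^bsub>V\<^esub> (v \<oplus>\<^bsub>V\<^esub> w)"
    using v by (simp add: quotient_rep_simps S.a_rcos_sum)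
  show "c \<in> carrier K \<Longrightarrow> c \<odot>\<^bsub>quotient_rep V U\<^esub> (U +>\<^bsub>V\<^esub> v) = U +>\<^bsub>V\<^esub> (c \<odot>\<^bsub>V\<^esub> v)"
    using v D coset_image_union[OF U, of "\<lambda>v. c \<odot>\<^bsub>V\<^esub> v"]
    by (simp add: quotient_rep_def smult_r_distr)
  show "g \<in> carrier G \<Longrightarrow> act (quotient_rep V U) g (U +>\<^bsub>V\<^esub> v) = U +>\<^bsub>V\<^esub> act V g v"
    using v D coset_image_union[OF U, of "act V g"]
    by (simp add: quotient_rep_def act_add act_closed)
qed

lemma (in representation) representation_quotient:
  assumes U: "subrepresentation G K V U"
  shows "representation G K (quotient_rep V U)"
proof -
  interpret S: abelian_subgroup U V by (rule subrep_abelian_subgroup[OF U])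
  let ?Q = "quotient_rep V U"
  note ops = quotient_rep_ops[OF U]
  have z: "zero ?Q = U +>\<^bsub>V\<^esub> \<zero>\<^bsub>V\<^esub>"
    using S.a_subset by (simp add: quotient_rep_simps)
  have "abelian_group ?Q"
  proof (rule abelian_groupI)
    fix x assume "x \<in> carrier ?Q"
    then obtain v where v: "v \<in> carrier V" "x = U +>\<^bsub>V\<^esub> v" by (auto simp: quotient_rep_simps)
    show "\<exists>y\<in>carrier ?Q. y \<oplus>\<^bsub>?Q\<^esub> x = \<zero>\<^bsub>?Q\<^esub>"
    proof (rule bexI[of _ "U +>\<^bsub>V\<^esub> \<ominus>\<^bsub>V\<^esub> v"])
      show "U +>\<^bsub>V\<^esub> \<ominus>\<^bsub>V\<^esub> v \<in> carrier ?Q" using v by (auto simp: quotient_rep_simps(1))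
      show "(U +>\<^bsub>V\<^esub> \<ominus>\<^bsub>V\<^esub> v) \<oplus>\<^bsub>?Q\<^esub> x = \<zero>\<^bsub>?Q\<^esub>" using v by (simp add: z ops M.l_neg)
    qed
  qed (auto simp: z ops quotient_rep_simps(1) M.add.m_ac)
  then interpret Q: abelian_group ?Q .
  have "module K ?Q"
    by (rule moduleI)
      (auto simp: ops quotient_rep_simps(1) Q.abelian_group_axioms is_cring
        smult_l_distr smult_r_distr smult_assoc1)
  then interpret Q: Module.module K ?Q .
  show ?thesis
    by unfold_locales
      (auto simp: ops quotient_rep_simps(1) act_closed act_add act_smult act_one act_mult)
qed

lemma (in representation) subrep_quotient_image:
  assumes W: "subrepresentation G K V W" and A: "subrepresentation G K V A"
  shows "subrepresentation G K (quotient_rep V W) ((\<lambda>v. W +>\<^bsub>V\<^esub> v) ` A)"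
proof -
  interpret S: abelian_subgroup W V by (rule subrep_abelian_subgroup[OF W])
  interpret Q: representation G K "quotient_rep V W" by (rule representation_quotient[OF W])
  note ops = quotient_rep_ops[OF W] and D = subrepD[OF A]
  have z: "zero (quotient_rep V W) = W +>\<^bsub>V\<^esub> \<zero>\<^bsub>V\<^esub>"
    using S.a_subset by (simp add: quotient_rep_simps)
  have c: "v \<in> carrier V" if "v \<in> A" for v using D(1) that by auto
  show ?thesis
    by (rule Q.subrepresentationI) (auto simp: z ops quotient_rep_simps(1) c intro!: imageI D)
qed

text \<open>
  The first isomorphism theorem. Prescribing the fibres of \<open>h\<close> as cosets expresses injectivity on the
  quotient without mentioning negatives or the zero of \<open>Z\<close>.
\<close>

lemma (in representation) quotient_rep_isomorphic:
  assumes U: "subrepresentation G K V U"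
    and onto: "h ` carrier V = carrier Z"
    and add: "\<And>v w. v \<in> carrier V \<Longrightarrow> w \<in> carrier V \<Longrightarrow> h (v \<oplus>\<^bsub>V\<^esub> w) = h v \<oplus>\<^bsub>Z\<^esub> h w"
    and smult: "\<And>c v. c \<in> carrier K \<Longrightarrow> v \<in> carrier V \<Longrightarrow> h (c \<odot>\<^bsub>V\<^esub> v) = c \<odot>\<^bsub>Z\<^esub> h v"
    and act: "\<And>g v. g \<in> carrier G \<Longrightarrow> v \<in> carrier V \<Longrightarrow> h (act V g v) = act Z g (h v)"
    and fibre: "\<And>v w. v \<in> carrier V \<Longrightarrow> w \<in> carrier V \<Longrightarrow> h v = h w \<longleftrightarrow> v \<in> U +>\<^bsub>V\<^esub> w"
  shows "rep_isomorphic G K (quotient_rep V U) Z"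
proof -
  interpret S: abelian_subgroup U V by (rule subrep_abelian_subgroup[OF U])
  let ?Q = "quotient_rep V U"
  note ops = quotient_rep_ops[OF U]
  define k where "k = (\<lambda>C. the_elem (h ` C))"
  have k: "k (U +>\<^bsub>V\<^esub> v) = h v" if v: "v \<in> carrier V" for v
  proof -
    have "U +>\<^bsub>V\<^esub> v \<subseteq> carrier V" using v S.a_subset by (auto simp: a_r_coset_iff)
    then have "h ` (U +>\<^bsub>V\<^esub> v) = {h v}"
      using fibre v S.a_rcos_self[OF v] by blast
    then show ?thesis by (simp add: k_def)
  qed
  have "k \<in> iso (add_monoid ?Q) (add_monoid Z)"
  proof (rule isoI)
    show "k \<in> hom (add_monoid ?Q) (add_monoid Z)"
      using onto by (intro homI) (auto simp: k ops add quotient_rep_simps(1))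
    show "bij_betw k (carrier (add_monoid ?Q)) (carrier (add_monoid Z))"
    proof (rule bij_betw_imageI)
      show "inj_on k (carrier (add_monoid ?Q))"
        using fibre S.a_repr_independence' by (auto simp del: a_r_coset_iff simp: inj_on_def k quotient_rep_simps(1))
      show "k ` carrier (add_monoid ?Q) = carrier (add_monoid Z)"
        using onto by (auto simp: k quotient_rep_simps(1) image_image)
    qed
  qed
  then show ?thesis
    unfolding rep_isomorphic_def
    by (intro bexI[of _ k]) (auto simp: k ops quotient_rep_simps(1) smult act act_closed)
qed

text \<open>
  The isomorphism \<open>(B/W)/(A/W) \<cong> B/A \<cong> Z\<close>, in the form in which graded pieces of a filtration of
  \<open>V/W\<close> present themselves.
\<close>

lemma (in representation) subquotient_rep_isomorphic:
  assumes W: "subrepresentation G K V W" and A: "subrepresentation G K V A"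
    and B: "subrepresentation G K V B" and WA: "W \<subseteq> A" and AB: "A \<subseteq> B"
    and onto: "h ` B = carrier Z"
    and add: "\<And>v w. v \<in> B \<Longrightarrow> w \<in> B \<Longrightarrow> h (v \<oplus>\<^bsub>V\<^esub> w) = h v \<oplus>\<^bsub>Z\<^esub> h w"
    and smult: "\<And>c v. c \<in> carrier K \<Longrightarrow> v \<in> B \<Longrightarrow> h (c \<odot>\<^bsub>V\<^esub> v) = c \<odot>\<^bsub>Z\<^esub> h v"
    and act: "\<And>g v. g \<in> carrier G \<Longrightarrow> v \<in> B \<Longrightarrow> h (act V g v) = act Z g (h v)"
    and fibre: "\<And>v w. v \<in> B \<Longrightarrow> w \<in> B \<Longrightarrow> h v = h w \<longleftrightarrow> v \<in> A +>\<^bsub>V\<^esub> w"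
    and Y_def: "Y = (quotient_rep V W)\<lparr>carrier := (\<lambda>v. W +>\<^bsub>V\<^esub> v) ` B\<rparr>"
  shows "representation G K (quotient_rep Y ((\<lambda>v. W +>\<^bsub>V\<^esub> v) ` A))"
    and "rep_isomorphic G K (quotient_rep Y ((\<lambda>v. W +>\<^bsub>V\<^esub> v) ` A)) Z"
proof -
  let ?Q = "quotient_rep V W"
  let ?\<pi> = "\<lambda>v. W +>\<^bsub>V\<^esub> v"
  interpret S: abelian_subgroup W V by (rule subrep_abelian_subgroup[OF W])
  interpret Q: representation G K ?Q by (rule representation_quotient[OF W])
  interpret Y: representation G K Y
    unfolding Y_def by (rule Q.representation_restrict[OF subrep_quotient_image[OF W B]])
  note ops = quotient_rep_ops[OF W] and DA = subrepD[OF A] and DB = subrepD[OF B]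
  have c: "v \<in> carrier V" if "v \<in> B" for v using DB(1) that by auto
  have cA: "v \<in> carrier V" if "v \<in> A" for v using DA(1) that by auto
  have YA: "subrepresentation G K Y (?\<pi> ` A)"
  proof (rule Y.subrepresentationI)
    show "?\<pi> ` A \<subseteq> carrier Y" using AB by (auto simp: Y_def)
  qed (use Q.subrepD[OF subrep_quotient_image[OF W A]] in \<open>auto simp: Y_def\<close>)
  show "representation G K (quotient_rep Y (?\<pi> ` A))"
    by (rule Y.representation_quotient[OF YA])
  have same: "h v = h w" if "v \<in> B" "w \<in> B" "?\<pi> v = ?\<pi> w" for v w
  proof -
    have "v \<in> W +>\<^bsub>V\<^esub> w" using that S.a_rcos_self[of v] c by auto
    then have "v \<in> A +>\<^bsub>V\<^esub> w" using WA by (auto simp: a_r_coset_iff)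
    then show ?thesis using fibre that by auto
  qed
  define k where "k = (\<lambda>C. h (SOME v. v \<in> B \<and> C = ?\<pi> v))"
  have k: "k (?\<pi> v) = h v" if v: "v \<in> B" for v
    using someI[of "\<lambda>w. w \<in> B \<and> ?\<pi> v = ?\<pi> w" v] v same unfolding k_def by blast
  have fibre': "h v = h w \<longleftrightarrow> ?\<pi> v \<in> ?\<pi> ` A +>\<^bsub>Y\<^esub> ?\<pi> w" if vw: "v \<in> B" "w \<in> B" for v w
  proof
    assume "h v = h w"
    then obtain a where "a \<in> A" "v = a \<oplus>\<^bsub>V\<^esub> w" using fibre vw by (auto simp: a_r_coset_iff)
    then show "?\<pi> v \<in> ?\<pi> ` A +>\<^bsub>Y\<^esub> ?\<pi> w"
      using vw by (auto simp: a_r_coset_iff Y_def ops c cA)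
  next
    assume "?\<pi> v \<in> ?\<pi> ` A +>\<^bsub>Y\<^esub> ?\<pi> w"
    then obtain a where a: "a \<in> A" "?\<pi> v = ?\<pi> (a \<oplus>\<^bsub>V\<^esub> w)"
      using vw by (auto simp: a_r_coset_iff Y_def ops c cA)
    have "a \<oplus>\<^bsub>V\<^esub> w \<in> B" using a(1) AB vw DB by auto
    moreover have "h (a \<oplus>\<^bsub>V\<^esub> w) = h w"
      using fibre[of "a \<oplus>\<^bsub>V\<^esub> w" w] calculation vw a by (auto simp: a_r_coset_iff)
    ultimately show "h v = h w" using same a vw by metis
  qed
  have Yc: "carrier Y = ?\<pi> ` B" by (simp add: Y_def)
  have Yops: "add Y = add ?Q" "module.smult Y = module.smult ?Q" "rep.act Y = rep.act ?Q"
    by (auto simp: Y_def)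
  show "rep_isomorphic G K (quotient_rep Y (?\<pi> ` A)) Z"
  proof (rule Y.quotient_rep_isomorphic[OF YA, where h = k])
    show "k ` carrier Y = carrier Z" using onto by (auto simp: Yc k image_image)
  next
    fix x y assume "x \<in> carrier Y" "y \<in> carrier Y"
    then show "k x = k y \<longleftrightarrow> x \<in> ?\<pi> ` A +>\<^bsub>Y\<^esub> y"
      using fibre' by (auto simp: Yc k)
  qed (auto simp: Yc Yops k ops c DB add smult act)
qed

section \<open>Substitution and coefficients\<close>

lemma mpoly_sum_monomials:
  "P = (\<Sum>t\<in>Poly_Mapping.keys P. Poly_Mapping.single t (Poly_Mapping.lookup P t))"
proof (rule poly_mapping_eqI)
  fix s
  show "Poly_Mapping.lookup P s =
      Poly_Mapping.lookup (\<Sum>t\<in>Poly_Mapping.keys P. Poly_Mapping.single t (Poly_Mapping.lookup P t)) s"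
    by (cases "s \<in> Poly_Mapping.keys P")
      (auto simp: lookup_sum lookup_single when_def in_keys_iff sum.delta' cong: if_cong)
qed

lemma Const_simps [simp]:
  "Const (0::'k::comm_ring_1) = 0" "Const (1::'k::comm_ring_1) = 1"
  "Poly_Mapping.lookup (Const c) 0 = c"
  by (auto simp: Const_def)

lemma Const_add: "Const (a + b :: 'k::comm_ring_1) = Const a + Const b"
  by (simp add: Const_def single_add)

lemma Const_mult: "Const (a * b :: 'k::comm_ring_1) = Const a * Const b"
  by (simp add: Const_def mult_single)

lemma Const_diff: "Const (a - b :: 'k::comm_ring_1) = Const a - Const b"
  by (simp add: Const_def single_diff)

lemma Const_power: "Const (a ^ n :: 'k::comm_ring_1) = Const a ^ n"
  by (induction n) (auto simp: Const_mult)

lemma Const_prod: "Const (prod a A :: 'k::comm_ring_1) = (\<Prod>i\<in>A. Const (a i))"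
  by (induction A rule: infinite_finite_induct) (auto simp: Const_mult)

lemma Const_times_single: "Const (a::'k::comm_ring_1) * Poly_Mapping.single t b = Poly_Mapping.single t (a * b)"
  by (simp add: Const_def mult_single)

text \<open>
  The image of a single monomial under \<open>subst\<close>. It is multiplicative in the exponent, and this is why
  \<open>subst\<close> is a ring homomorphism.
\<close>

definition monom_subst :: "(var \<Rightarrow> 'k mpoly) \<Rightarrow> (var \<Rightarrow>\<^sub>0 nat) \<Rightarrow> 'k::comm_ring_1 mpoly"
  where "monom_subst \<sigma> t = (\<Prod>v\<in>Poly_Mapping.keys t. \<sigma> v ^ Poly_Mapping.lookup t v)"

lemma monom_subst_superset:
  assumes "finite A" "Poly_Mapping.keys t \<subseteq> A"
  shows "monom_subst \<sigma> t = (\<Prod>v\<in>A. \<sigma> v ^ Poly_Mapping.lookup t v)"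
  unfolding monom_subst_def
  by (rule prod.mono_neutral_left) (use assms in \<open>auto simp: in_keys_iff\<close>)

lemma monom_subst_add: "monom_subst \<sigma> (s + t) = monom_subst \<sigma> s * monom_subst \<sigma> t"
proof -
  let ?A = "Poly_Mapping.keys s \<union> Poly_Mapping.keys t"
  have "Poly_Mapping.keys (s + t) \<subseteq> ?A" by (rule Poly_Mapping.keys_add)
  then show ?thesis
    by (simp add: monom_subst_superset[of ?A] lookup_add power_add prod.distrib)
qed

lemma monom_subst_zero [simp]: "monom_subst \<sigma> 0 = 1"
  by (simp add: monom_subst_def)

lemma monom_subst_single [simp]: "monom_subst \<sigma> (Poly_Mapping.single v n) = \<sigma> v ^ n"
  by (simp add: monom_subst_def)

lemma subst_superset:
  assumes "finite A" "Poly_Mapping.keys P \<subseteq> A"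
  shows "subst \<sigma> P = (\<Sum>t\<in>A. Const (Poly_Mapping.lookup P t) * monom_subst \<sigma> t)"
  unfolding subst_def monom_subst_def[symmetric]
  by (rule sum.mono_neutral_left) (use assms in \<open>auto simp: in_keys_iff\<close>)

lemma subst_add: "subst \<sigma> (P + Q) = subst \<sigma> P + subst \<sigma> Q"
proof -
  let ?A = "Poly_Mapping.keys P \<union> Poly_Mapping.keys Q"
  have "Poly_Mapping.keys (P + Q) \<subseteq> ?A" by (rule Poly_Mapping.keys_add)
  then show ?thesis
    by (simp add: subst_superset[of ?A] lookup_add Const_add ring_distribs sum.distrib)
qed

lemma subst_zero [simp]: "subst \<sigma> 0 = 0"
  by (simp add: subst_def)

lemma subst_single: "subst \<sigma> (Poly_Mapping.single t c) = Const c * monom_subst \<sigma> t"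
  by (cases "c = 0") (auto simp: subst_def monom_subst_def)

lemma subst_sum: "subst \<sigma> (sum P A) = (\<Sum>i\<in>A. subst \<sigma> (P i))"
  by (induction A rule: infinite_finite_induct) (auto simp: subst_add)

lemma subst_diff: "subst \<sigma> (P - Q) = subst \<sigma> P - subst \<sigma> Q"
  using subst_add[of \<sigma> "P - Q" Q] by simp

lemma subst_mult: "subst \<sigma> (P * Q) = subst \<sigma> P * subst \<sigma> Q"
proof -
  let ?s = "\<lambda>P t. Poly_Mapping.single t (Poly_Mapping.lookup P t)"
  have "subst \<sigma> (?s P s * ?s Q t) = subst \<sigma> (?s P s) * subst \<sigma> (?s Q t)" for s t
    by (simp add: mult_single subst_single Const_mult monom_subst_add mult_ac)
  then have "subst \<sigma> (sum (?s P) (Poly_Mapping.keys P) * sum (?s Q) (Poly_Mapping.keys Q)) =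
      subst \<sigma> (sum (?s P) (Poly_Mapping.keys P)) * subst \<sigma> (sum (?s Q) (Poly_Mapping.keys Q))"
    by (simp add: sum_product subst_sum)
  then show ?thesis by (simp add: mpoly_sum_monomials[symmetric])
qed

lemma subst_Const [simp]: "subst \<sigma> (Const c) = Const c"
  unfolding Const_def[of c] subst_single by simp

lemma subst_one [simp]: "subst \<sigma> 1 = 1"
  using subst_Const[of \<sigma> 1] by simp

lemma subst_Var [simp]: "subst \<sigma> (Var v) = \<sigma> v"
  by (simp add: Var_def subst_single)

lemma subst_power: "subst \<sigma> (P ^ n) = subst \<sigma> P ^ n"
  by (induction n) (auto simp: subst_mult)

lemma subst_prod: "subst \<sigma> (prod P A) = (\<Prod>i\<in>A. subst \<sigma> (P i))"
  by (induction A rule: infinite_finite_induct) (auto simp: subst_mult)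

lemma subst_monom_subst: "subst \<sigma> (monom_subst \<tau> t) = monom_subst (\<lambda>v. subst \<sigma> (\<tau> v)) t"
  by (simp add: monom_subst_def subst_prod subst_power)

lemma subst_subst: "subst \<sigma> (subst \<tau> P) = subst (\<lambda>v. subst \<sigma> (\<tau> v)) P"
proof -
  have "subst \<sigma> (subst \<tau> P) =
      (\<Sum>t\<in>Poly_Mapping.keys P. Const (Poly_Mapping.lookup P t) * monom_subst (\<lambda>v. subst \<sigma> (\<tau> v)) t)"
    by (simp add: subst_superset[of "Poly_Mapping.keys P" P] subst_sum subst_mult subst_monom_subst)
  then show ?thesis by (simp add: subst_superset[of "Poly_Mapping.keys P" P])
qed

lemma Var_power: "Var v ^ n = (Poly_Mapping.single (Poly_Mapping.single v n) 1 :: 'k::comm_ring_1 mpoly)"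
  by (induction n) (auto simp: Var_def mult_single single_add[symmetric])

lemma prod_Var_power:
  "finite A \<Longrightarrow> (\<Prod>v\<in>A. Var v ^ n v) =
    (Poly_Mapping.single (\<Sum>v\<in>A. Poly_Mapping.single v (n v)) 1 :: 'k::comm_ring_1 mpoly)"
  by (induction A rule: finite_induct) (auto simp: Var_power mult_single)

lemma monom_subst_Var: "monom_subst Var t = (Poly_Mapping.single t 1 :: 'k::comm_ring_1 mpoly)"
  by (simp add: monom_subst_def prod_Var_power mpoly_sum_monomials[symmetric])

lemma subst_Var_id [simp]: "subst Var P = P"
  by (simp add: subst_superset[of "Poly_Mapping.keys P" P] monom_subst_Var Const_times_single
      mpoly_sum_monomials[symmetric])

lemma exponent_add_eq_0_iff: "s + t = 0 \<longleftrightarrow> s = 0 \<and> t = (0 :: var \<Rightarrow>\<^sub>0 nat)"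
  by (auto simp: poly_mapping_eq_iff fun_eq_iff lookup_add)

text \<open>
  Reading coefficients of a multiple of a monomial: only exponents above that of the monomial occur,
  and they are shifts of the exponents of the cofactor.
\<close>

lemma lookup_single_mult:
  "Poly_Mapping.lookup (Poly_Mapping.single t c * R) (t + s) = c * Poly_Mapping.lookup (R :: 'k::comm_ring_1 mpoly) s"
proof -
  let ?s = "\<lambda>u. Poly_Mapping.single u (Poly_Mapping.lookup R u)"
  have "Poly_Mapping.lookup (Poly_Mapping.single t c * ?s u) (t + s) = c * Poly_Mapping.lookup (?s u) s" for u
    by (simp add: mult_single lookup_single when_def)
  then have "Poly_Mapping.lookup (Poly_Mapping.single t c * sum ?s (Poly_Mapping.keys R)) (t + s)
      = c * Poly_Mapping.lookup (sum ?s (Poly_Mapping.keys R)) s"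
    by (simp add: sum_distrib_left lookup_sum)
  then show ?thesis by (simp add: mpoly_sum_monomials[symmetric])
qed

lemma lookup_single_mult_eq_0:
  assumes "\<And>s. e \<noteq> t + s"
  shows "Poly_Mapping.lookup (Poly_Mapping.single t c * (R :: 'k::comm_ring_1 mpoly)) e = 0"
proof -
  have "e \<notin> Poly_Mapping.keys (Poly_Mapping.single t c * R)"
  proof
    assume "e \<in> Poly_Mapping.keys (Poly_Mapping.single t c * R)"
    then have "e \<in> {a + b | a b. a \<in> Poly_Mapping.keys (Poly_Mapping.single t c) \<and> b \<in> Poly_Mapping.keys R}"
      using keys_mult by blast
    then show False using assms by (auto split: if_splits)
  qed
  then show ?thesis by (simp add: in_keys_iff)
qed

lemma lookup_mult_0:
  "Poly_Mapping.lookup (P * Q) 0 = Poly_Mapping.lookup P 0 * Poly_Mapping.lookup (Q :: 'k::comm_ring_1 mpoly) 0"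
proof -
  let ?s = "\<lambda>P u. Poly_Mapping.single u (Poly_Mapping.lookup (P :: 'k mpoly) u)"
  have "Poly_Mapping.lookup (?s P s * ?s Q t) 0 = Poly_Mapping.lookup (?s P s) 0 * Poly_Mapping.lookup (?s Q t) 0" for s t
    by (auto simp: mult_single lookup_single when_def exponent_add_eq_0_iff)
  then have "Poly_Mapping.lookup (sum (?s P) (Poly_Mapping.keys P) * sum (?s Q) (Poly_Mapping.keys Q)) 0 =
      Poly_Mapping.lookup (sum (?s P) (Poly_Mapping.keys P)) 0 * Poly_Mapping.lookup (sum (?s Q) (Poly_Mapping.keys Q)) 0"
    by (simp add: sum_product lookup_sum)
  then show ?thesis by (simp add: mpoly_sum_monomials[symmetric])
qed


lemma lookup_power_0: "Poly_Mapping.lookup ((P :: 'k::comm_ring_1 mpoly) ^ n) 0 = Poly_Mapping.lookup P 0 ^ n"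
  by (induction n) (auto simp: lookup_mult_0)

lemma lookup_prod_0:
  "Poly_Mapping.lookup (prod P A :: 'k::comm_ring_1 mpoly) 0 = (\<Prod>i\<in>A. Poly_Mapping.lookup (P i) 0)"
  by (induction A rule: infinite_finite_induct) (auto simp: lookup_mult_0)

text \<open>
  The constant coefficient is a ring homomorphism, so evaluation at a point can be defined through
  \<open>subst\<close> and inherits its rules.
\<close>

definition peval :: "(var \<Rightarrow> 'k) \<Rightarrow> 'k::comm_ring_1 mpoly \<Rightarrow> 'k"
  where "peval \<xi> P = Poly_Mapping.lookup (subst (\<lambda>v. Const (\<xi> v)) P) 0"

lemma lookup_subst_0:
  "Poly_Mapping.lookup (subst \<sigma> P) 0 = peval (\<lambda>v. Poly_Mapping.lookup (\<sigma> v) 0) P"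
proof -
  have "Poly_Mapping.lookup (subst \<sigma> P) 0 =
      (\<Sum>t\<in>Poly_Mapping.keys P. Poly_Mapping.lookup P t *
        (\<Prod>v\<in>Poly_Mapping.keys t. Poly_Mapping.lookup (\<sigma> v) 0 ^ Poly_Mapping.lookup t v))" for \<sigma>
    by (simp add: subst_def lookup_sum lookup_mult_0 lookup_prod_0 lookup_power_0)
  then show ?thesis by (simp add: peval_def)
qed

lemma peval_simps [simp]:
  "peval \<xi> 0 = 0" "peval \<xi> 1 = 1" "peval \<xi> (Const c) = c" "peval \<xi> (Var v) = \<xi> v"
  "peval \<xi> (P + Q) = peval \<xi> P + peval \<xi> Q"
  "peval \<xi> (P - Q) = peval \<xi> P - peval \<xi> Q"
  "peval \<xi> (P * Q) = peval \<xi> P * peval \<xi> Q"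
  "peval \<xi> (P ^ n) = peval \<xi> P ^ n"
  by (simp_all add: peval_def subst_add subst_diff subst_mult subst_power lookup_add lookup_minus
      lookup_mult_0 lookup_power_0)

lemma peval_sum: "peval \<xi> (sum P A) = (\<Sum>i\<in>A. peval \<xi> (P i))"
  by (simp add: peval_def subst_sum lookup_sum)

lemma peval_prod: "peval \<xi> (prod P A) = (\<Prod>i\<in>A. peval \<xi> (P i))"
  by (simp add: peval_def subst_prod lookup_prod_0)

lemma peval_subst: "peval \<xi> (subst \<tau> P) = peval (\<lambda>v. peval \<xi> (\<tau> v)) P"
  by (simp only: peval_def[of \<xi> "subst \<tau> P"] peval_def[of \<xi> "\<tau> _"] subst_subst lookup_subst_0)


section \<open>Multi-homogeneous polynomials\<close>

definition multidegree :: "(var \<Rightarrow>\<^sub>0 nat) \<Rightarrow> nat \<Rightarrow> nat"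
  where "multidegree t i = Poly_Mapping.lookup t (Xvar i) + Poly_Mapping.lookup t (Yvar i)"

definition homogeneous :: "(nat \<Rightarrow> nat) \<Rightarrow> 'k::comm_ring_1 mpoly set"
  where "homogeneous d = {P. \<forall>t\<in>Poly_Mapping.keys P. multidegree t = d}"

lemma V_carrier_eq: "V_carrier f r = homogeneous (\<lambda>i. if i < f then r i else 0)"
  by (auto simp: V_carrier_def homogeneous_def multidegree_def fun_eq_iff)

lemma multidegree_add: "multidegree (s + t) = (\<lambda>i. multidegree s i + multidegree t i)"
  by (auto simp: multidegree_def lookup_add)

lemma homogeneous_zero [simp]: "0 \<in> homogeneous d"
  by (simp add: homogeneous_def)

lemma homogeneous_add: "P \<in> homogeneous d \<Longrightarrow> Q \<in> homogeneous d \<Longrightarrow> P + Q \<in> homogeneous d"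
  using Poly_Mapping.keys_add[of P Q] by (auto simp: homogeneous_def)

lemma homogeneous_sum: "(\<And>i. i \<in> A \<Longrightarrow> P i \<in> homogeneous d) \<Longrightarrow> sum P A \<in> homogeneous d"
  by (induction A rule: infinite_finite_induct) (auto simp: homogeneous_add)

lemma homogeneous_mult:
  assumes "P \<in> homogeneous d" "Q \<in> homogeneous e"
  shows "P * Q \<in> homogeneous (\<lambda>i. d i + e i)"
proof -
  have "multidegree t = (\<lambda>i. d i + e i)" if t: "t \<in> Poly_Mapping.keys (P * Q)" for t
  proof -
    obtain a b where "t = a + b" "a \<in> Poly_Mapping.keys P" "b \<in> Poly_Mapping.keys Q"
      using t keys_mult[of P Q] by blast
    then show ?thesis using assms by (auto simp: homogeneous_def multidegree_add)
  qed
  then show ?thesis by (simp add: homogeneous_def)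
qed

lemma homogeneous_single: "Poly_Mapping.single t c \<in> homogeneous (multidegree t)"
  by (simp add: homogeneous_def)

lemma homogeneous_Const: "Const c \<in> homogeneous (\<lambda>i. 0)"
  by (auto simp: homogeneous_def Const_def multidegree_def)

lemma homogeneous_Const_mult: "P \<in> homogeneous d \<Longrightarrow> Const c * P \<in> homogeneous d"
  using homogeneous_mult[OF homogeneous_Const, of P d c] by simp

lemma homogeneous_uminus: "P \<in> homogeneous d \<Longrightarrow> - P \<in> homogeneous d"
  by (simp add: homogeneous_def)

lemma homogeneous_diff: "P \<in> homogeneous d \<Longrightarrow> Q \<in> homogeneous d \<Longrightarrow> P - Q \<in> homogeneous d"
  using homogeneous_add[of P d "- Q"] homogeneous_uminus[of Q d] by simp

lemma homogeneous_one: "1 \<in> homogeneous (\<lambda>i. 0)"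
  using homogeneous_Const[of 1] by simp

lemma homogeneous_power: "P \<in> homogeneous d \<Longrightarrow> P ^ n \<in> homogeneous (\<lambda>i. n * d i)"
  by (induction n) (auto simp: homogeneous_one dest: homogeneous_mult)

lemma homogeneous_prod:
  "(\<And>j. j \<in> A \<Longrightarrow> P j \<in> homogeneous (d j)) \<Longrightarrow> prod P A \<in> homogeneous (\<lambda>i. \<Sum>j\<in>A. d j i)"
  by (induction A rule: infinite_finite_induct) (auto simp: homogeneous_one dest: homogeneous_mult)

lemma homogeneous_Var:
  "Var (Xvar i) \<in> homogeneous (\<lambda>j. if j = i then 1 else 0)"
  "Var (Yvar i) \<in> homogeneous (\<lambda>j. if j = i then 1 else 0)"
  by (auto simp: homogeneous_def Var_def multidegree_def lookup_single when_def)

text \<open>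
  The component of the right multidegree of any cofactor is again a cofactor, since the other
  components contribute nothing in the multidegree of the product.
\<close>

lemma homogeneous_cofactor:
  assumes g: "g \<in> homogeneous d" and gP: "g * P \<in> homogeneous r" and le: "\<And>i. d i \<le> r i"
  shows "\<exists>Q \<in> homogeneous (\<lambda>i. r i - d i). g * P = g * Q"
proof -
  let ?s = "\<lambda>t. Poly_Mapping.single t (Poly_Mapping.lookup P t)"
  define e where "e = (\<lambda>i. r i - d i)"
  define Q where "Q = sum ?s {t \<in> Poly_Mapping.keys P. multidegree t = e}"
  define R where "R = sum ?s {t \<in> Poly_Mapping.keys P. multidegree t \<noteq> e}"
  have "P = Q + R"
    unfolding Q_def R_def
    by (subst mpoly_sum_monomials, subst sum.union_disjoint[symmetric]) (auto intro!: sum.cong)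
  have Q: "Q \<in> homogeneous e"
    unfolding Q_def by (rule homogeneous_sum) (auto simp: homogeneous_def)
  have R: "multidegree t \<noteq> e" if "t \<in> Poly_Mapping.keys R" for t
    using that unfolding R_def
    by (auto simp: lookup_sum lookup_single when_def in_keys_iff elim!: sum.not_neutral_contains_not_neutral split: if_splits)
  have de: "(\<lambda>i. d i + e i) = r" using le by (auto simp: e_def)
  have "g * R = g * P - g * Q" by (simp add: \<open>P = Q + R\<close> ring_distribs)
  then have gR: "g * R \<in> homogeneous r"
    using gP homogeneous_mult[OF g Q] de by (auto intro: homogeneous_diff)
  have "g * R = 0"
  proof (rule ccontr)
    assume "g * R \<noteq> 0"
    then obtain t where t: "t \<in> Poly_Mapping.keys (g * R)" by (metis keys_eq_empty ex_in_conv)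
    then obtain a b where ab: "t = a + b" "a \<in> Poly_Mapping.keys g" "b \<in> Poly_Mapping.keys R"
      using keys_mult[of g R] by blast
    have "multidegree t = r" using t gR by (auto simp: homogeneous_def)
    moreover have "multidegree a = d" using ab g by (auto simp: homogeneous_def)
    ultimately have "multidegree b = e" using ab by (auto simp: multidegree_add e_def)
    then show False using R ab by auto
  qed
  then show ?thesis using Q \<open>P = Q + R\<close> by (auto simp: e_def ring_distribs)
qed

section \<open>The representation \<open>V\<^sub>r\<close>\<close>

lemma invertible_2: "invertible (A :: 'k::field^2^2) \<longleftrightarrow> A$1$1 * A$2$2 - A$1$2 * A$2$1 \<noteq> 0"
  by (simp add: invertible_det_nz det_2)

lemma GL2_simps [simp]:
  "A \<in> carrier GL2 \<longleftrightarrow> invertible A" "monoid.mult GL2 = (**)" "monoid.one GL2 = mat 1"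
  by (auto simp: GL2_def)

lemma group_GL2: "Group.group (GL2 :: ('k::field^2^2) monoid)"
proof (rule groupI)
  fix A :: "'k^2^2" assume "A \<in> carrier GL2"
  then obtain B where "A ** B = mat 1" "B ** A = mat 1" by (auto simp: invertible_def)
  then show "\<exists>B\<in>carrier GL2. B \<otimes>\<^bsub>GL2\<^esub> A = \<one>\<^bsub>GL2\<^esub>"
    by (intro bexI[of _ B]) (auto simp: invertible_def)
qed (auto simp: invertible_mult matrix_mul_assoc invertible_def[of "mat 1"])

lemma ring_of_type_algebra_simps [simp]:
  "carrier (ring_of_type_algebra :: 'k::field ring) = UNIV"
  "monoid.mult (ring_of_type_algebra :: 'k::field ring) = (*)"
  "monoid.one (ring_of_type_algebra :: 'k::field ring) = 1"
  "ring.zero (ring_of_type_algebra :: 'k::field ring) = 0"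
  "ring.add (ring_of_type_algebra :: 'k::field ring) = (+)"
  by (auto simp: ring_of_type_algebra_def)

lemma V_rep_simps [simp]:
  "carrier (V_rep p f r) = V_carrier f r" "ring.zero (V_rep p f r) = 0" "ring.add (V_rep p f r) = (+)"
  "module.smult (V_rep p f r) = (\<lambda>c P. Const c * P)"
  "rep.act (V_rep p f r) = (\<lambda>A. subst (frob_subst p A))"
  by (auto simp: V_rep_def)

text \<open>
  The argument of type \<open>itself\<close> makes the coefficient field a parameter of the locale.
\<close>

locale finite_field_size =
  fixes p f q :: nat and ty :: "'k::{field,finite} itself"
  assumes prime_p: "prime p" and f_pos: "f \<ge> 1" and q_def: "q = p ^ f" and card_k: "CARD('k) = q"
begin

lemma p_gt_1: "p > 1" using prime_p by (rule prime_gt_1_nat)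

lemma q_gt_1: "q > 1" unfolding q_def using p_gt_1 f_pos by (intro one_less_power) auto

lemma CHAR_k: "CHAR('k) = p"
proof -
  have "CHAR('k) > 0" by (rule finite_imp_CHAR_pos) simp
  then have "prime CHAR('k)" by (rule prime_CHAR_semidom)
  moreover have "CHAR('k) dvd p ^ f"
  proof -
    have "(\<Sum>x\<in>UNIV. x + 1) = (\<Sum>x\<in>UNIV. x :: 'k)"
      by (rule sum.reindex_bij_witness[of _ "\<lambda>x. x - 1" "\<lambda>x. x + 1"]) auto
    then have "of_nat CARD('k) = (0 :: 'k)" by (simp add: sum.distrib)
    then show ?thesis by (metis card_k of_nat_eq_0_iff_char_dvd q_def)
  qed
  ultimately show ?thesis using prime_p by (metis prime_dvd_power primes_dvd_imp_eq)
qed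

lemma CHAR_mpoly: "CHAR('k mpoly) = p"
proof -
  have "of_nat n = (Const (of_nat n) :: 'k mpoly)" for n
    by (induction n) (auto simp: Const_add)
  then have "(of_nat n = (0 :: 'k mpoly)) \<longleftrightarrow> p dvd n" for n
    using of_nat_eq_0_iff_char_dvd[where 'a='k, of n] by (metis CHAR_k Const_simps(1,3) lookup_zero)
  then show ?thesis by (intro CHAR_eqI) auto
qed

lemma frobenius_add: "((a::'k) + b) ^ (p ^ i) = a ^ (p ^ i) + b ^ (p ^ i)"
  by (rule freshmans_dream') (auto simp: CHAR_k prime_p)

lemma frobenius_diff: "((a::'k) - b) ^ (p ^ i) = a ^ (p ^ i) - b ^ (p ^ i)"
  using frobenius_add[of "a - b" b i] by simp

lemma frobenius_mpoly_add: "((P::'k mpoly) + Q) ^ p = P ^ p + Q ^ p"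
  by (rule freshmans_dream) (auto simp: CHAR_mpoly prime_p)

lemma frobenius_mpoly_sum: "(sum (P :: 'a \<Rightarrow> 'k mpoly) A) ^ p = (\<Sum>i\<in>A. P i ^ p)"
  by (rule freshmans_dream_sum) (auto simp: CHAR_mpoly prime_p)

text \<open>
  Multiplication by \<open>x\<close> permutes the nonzero elements, so it does not change their product.
\<close>

lemma power_q_minus_1: "(x::'k) \<noteq> 0 \<Longrightarrow> x ^ (q - 1) = 1"
proof -
  assume x: "x \<noteq> 0"
  have "(\<Prod>y\<in>UNIV - {0}. x * y) = (\<Prod>y\<in>UNIV - {0::'k}. y)"
    by (rule prod.reindex_bij_witness[of _ "\<lambda>y. y / x" "\<lambda>y. x * y"]) (use x in auto)
  then have "x ^ (q - 1) * (\<Prod>y\<in>UNIV - {0::'k}. y) = (\<Prod>y\<in>UNIV - {0::'k}. y)"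
    by (simp add: prod.distrib card_k card_Diff_singleton)
  moreover have "(\<Prod>y\<in>UNIV - {0::'k}. y) \<noteq> 0" by simp
  ultimately show ?thesis by simp
qed

lemma power_q: "(x::'k) ^ q = x"
proof (cases "x = 0")
  case False
  have "x ^ q = x ^ (q - 1) * x" using q_gt_1 by (metis Suc_diff_1 less_trans power_Suc2 zero_less_one)
  then show ?thesis using power_q_minus_1[OF False] by simp
qed (use q_gt_1 in auto)

lemma frob_subst_mult: "subst (frob_subst p A) (frob_subst p B v) = frob_subst p (A ** (B :: 'k^2^2)) v"
  by (cases v) (simp_all add: matrix_matrix_mult_def sum_2 subst_add subst_mult frobenius_add
      power_mult_distrib Const_add Const_mult algebra_simps)

lemma frob_subst_one: "frob_subst p (mat 1 :: 'k^2^2) = Var"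
proof
  fix v show "frob_subst p (mat 1 :: 'k^2^2) v = Var v"
    using p_gt_1 by (cases v) (simp_all add: mat_def power_0_left)
qed

lemma homogeneous_frob_subst:
  assumes P: "P \<in> homogeneous d"
  shows "subst (frob_subst p A) P \<in> homogeneous d"
proof -
  have v: "frob_subst p A (Xvar i) \<in> homogeneous (\<lambda>j. if j = i then 1 else 0)"
    "frob_subst p A (Yvar i) \<in> homogeneous (\<lambda>j. if j = i then 1 else 0)" for i
    by (auto intro!: homogeneous_add homogeneous_Const_mult homogeneous_Var)
  define idx where "idx = (\<lambda>v. case v of Xvar i \<Rightarrow> i | Yvar i \<Rightarrow> i)"
  have v: "frob_subst p A v \<in> homogeneous (\<lambda>j. if j = idx v then 1 else 0)" for v
    using v[of "idx v"] by (cases v) (auto simp: idx_def)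
  have "monom_subst (frob_subst p A) t \<in> homogeneous (multidegree t)" for t
  proof -
    let ?d = "\<lambda>i. \<Sum>v\<in>Poly_Mapping.keys t. Poly_Mapping.lookup t v * (if i = idx v then 1 else 0)"
    have "monom_subst (frob_subst p A) t \<in> homogeneous ?d"
      unfolding monom_subst_def by (intro homogeneous_prod homogeneous_power v)
    moreover have "?d i = multidegree t i" for i
    proof -
      have "?d i = (\<Sum>v\<in>Poly_Mapping.keys t \<union> {Xvar i, Yvar i}. Poly_Mapping.lookup t v * (if i = idx v then 1 else 0))"
        by (rule sum.mono_neutral_left) (auto simp: in_keys_iff)
      also have "\<dots> = (\<Sum>v\<in>{Xvar i, Yvar i}. Poly_Mapping.lookup t v * (if i = idx v then 1 else 0))"
        by (rule sum.mono_neutral_right) (auto simp: idx_def split: var.splits)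
      finally show ?thesis by (simp add: idx_def multidegree_def)
    qed
    ultimately show ?thesis by (simp add: fun_eq_iff[symmetric])
  qed
  moreover have "multidegree t = d" if "t \<in> Poly_Mapping.keys P" for t
    using P that by (simp add: homogeneous_def)
  ultimately have "monom_subst (frob_subst p A) t \<in> homogeneous d" if "t \<in> Poly_Mapping.keys P" for t
    using that by metis
  then show ?thesis
    unfolding subst_def monom_subst_def[symmetric]
    by (intro homogeneous_sum homogeneous_Const_mult)
qed

lemma representation_V:
  "representation GL2 ring_of_type_algebra (V_rep p f r :: ('k, 'k mpoly, 'k^2^2) rep)"
proof -
  let ?V = "V_rep p f r :: ('k, 'k mpoly, 'k^2^2) rep"
  interpret G: Group.group "GL2 :: ('k^2^2) monoid" by (rule group_GL2)
  interpret K: field "ring_of_type_algebra :: 'k ring" by (rule field_from_type_algebra)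
  have "abelian_group ?V"
  proof (rule abelian_groupI)
    fix P assume "P \<in> carrier ?V"
    then show "\<exists>Q\<in>carrier ?V. Q \<oplus>\<^bsub>?V\<^esub> P = \<zero>\<^bsub>?V\<^esub>"
      by (intro bexI[of _ "- P"]) (auto simp: V_carrier_eq homogeneous_uminus)
  qed (auto simp: V_carrier_eq homogeneous_add algebra_simps)
  then interpret V: abelian_group ?V .
  interpret V: Module.module "ring_of_type_algebra :: 'k ring" ?V
    by (rule moduleI) (simp_all add: K.is_cring V.abelian_group_axioms V_carrier_eq homogeneous_Const_mult
        Const_add Const_mult ring_distribs mult.assoc)
  show ?thesis
    by unfold_locales (auto simp: V_carrier_eq homogeneous_frob_subst subst_add subst_mult subst_subst
        frob_subst_mult frob_subst_one)
qed

section \<open>Twisted Dickson polynomials\<close>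

definition prev :: "nat \<Rightarrow> nat"
  where "prev i = (if i = 0 then f - 1 else i - 1)"

lemma theta_eq: "theta p f i = Var (Xvar i) * Var (Yvar (prev i)) ^ p - Var (Yvar i) * Var (Xvar (prev i)) ^ p"
  by (simp add: theta_def prev_def Let_def)

lemma prev_less: "i < f \<Longrightarrow> prev i < f"
  by (auto simp: prev_def)

text \<open>
  For \<open>i > 0\<close> this is a law of exponents; for \<open>i = 0\<close> the left side is \<open>a^q\<close>, and \<open>a^q = a\<close> closes the cycle.
\<close>

lemma frobenius_prev: "i < f \<Longrightarrow> ((a::'k) ^ (p ^ prev i)) ^ p = a ^ (p ^ i)"
  using f_pos power_q by (cases i) (auto simp: prev_def q_def simp flip: power_mult power_Suc2)

text \<open>
  The pairs \<open>(x_i, y_i)\<close> and \<open>(x_{i-1}^p, y_{i-1}^p)\<close> are transformed by the same matrix, and \<open>\<theta>_i\<close> is the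
  determinant of the two.
\<close>

lemma theta_semi_invariant:
  assumes "i < f"
  shows "subst (frob_subst p A) (theta p f i) = Const (det (A :: 'k^2^2) ^ (p ^ i)) * theta p f i"
proof -
  have "subst (frob_subst p A) (Var (Xvar (prev i)) ^ p) =
      Const (A$1$1 ^ p^i) * Var (Xvar (prev i)) ^ p + Const (A$2$1 ^ p^i) * Var (Yvar (prev i)) ^ p"
    "subst (frob_subst p A) (Var (Yvar (prev i)) ^ p) =
      Const (A$1$2 ^ p^i) * Var (Xvar (prev i)) ^ p + Const (A$2$2 ^ p^i) * Var (Yvar (prev i)) ^ p"
    using assms by (simp_all add: subst_power frobenius_mpoly_add power_mult_distrib frobenius_prev
        flip: Const_power)
  then show ?thesis
    by (simp add: theta_eq subst_diff subst_mult det_2 frobenius_diff power_mult_distrib Const_diff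
        Const_mult algebra_simps)
qed

definition theta_pow :: "(nat \<Rightarrow> nat) \<Rightarrow> 'k mpoly"
  where "theta_pow e = (\<Prod>i<f. theta p f i ^ e i)"

lemma theta_pow_semi_invariant:
  "subst (frob_subst p A) (theta_pow e) = Const (det (A :: 'k^2^2) ^ (\<Sum>i<f. e i * p ^ i)) * theta_pow e"
  by (simp add: theta_pow_def subst_prod subst_power theta_semi_invariant power_mult_distrib
      prod.distrib Const_prod power_sum mult.commute[of "e _"] power_mult Const_power)

lemma theta_power_eq: "i < f \<Longrightarrow> theta p f i ^ n = theta_pow (\<lambda>j. if j = i then n else 0)"
  by (simp add: theta_pow_def if_distrib[of "\<lambda>n. _ ^ n"] prod.delta' cong: if_cong)

lemma theta_pow_add: "theta_pow (\<lambda>i. e i + e' i) = theta_pow e * theta_pow e'"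
  by (simp add: theta_pow_def power_add prod.distrib)

text \<open>
  The multidegree of \<open>theta_pow e\<close>: \<open>\<theta>_i\<close> contributes \<open>1\<close> at \<open>i\<close> and \<open>p\<close> at the preceding index, and both
  contributions add up at the only index if \<open>f = 1\<close>.
\<close>

definition theta_pow_degree :: "(nat \<Rightarrow> nat) \<Rightarrow> nat \<Rightarrow> nat"
  where "theta_pow_degree e j = (\<Sum>i<f. e i * ((if j = i then 1 else 0) + p * (if j = prev i then 1 else 0)))"

lemma homogeneous_theta:
  "(theta p f i :: 'k mpoly) \<in> homogeneous (\<lambda>j. (if j = i then 1 else 0) + p * (if j = prev i then 1 else 0))"
  unfolding theta_eq
  by (intro homogeneous_diff homogeneous_mult homogeneous_Var homogeneous_power)

lemma homogeneous_theta_pow: "theta_pow e \<in> homogeneous (theta_pow_degree e)"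
  unfolding theta_pow_def theta_pow_degree_def[abs_def]
  by (intro homogeneous_prod homogeneous_power homogeneous_theta)

lemma inj_on_prev: "inj_on prev {..<f}"
  by (auto simp: inj_on_def prev_def split: if_splits)

lemma theta_pow_degree_le:
  assumes "\<And>i. i < f \<Longrightarrow> e i \<le> m"
  shows "theta_pow_degree e j \<le> (if j < f then m + m * p else 0)"
proof (cases "j < f")
  case True
  have "theta_pow_degree e j \<le> (\<Sum>i<f. m * (if j = i then 1 else 0)) + (\<Sum>i<f. m * p * (if j = prev i then 1 else 0))"
    unfolding theta_pow_degree_def sum.distrib[symmetric]
  proof (rule sum_mono)
    fix i assume "i \<in> {..<f}"
    then have "e i \<le> m" "e i * p \<le> m * p" using assms by auto
    then show "e i * ((if j = i then 1 else 0) + p * (if j = prev i then 1 else 0))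
        \<le> m * (if j = i then 1 else 0) + m * p * (if j = prev i then 1 else 0)"
      by (auto simp: add_mult_distrib2 intro: add_mono)
  qed
  also have "(\<Sum>i<f. m * (if j = i then 1 else 0)) = m"
    using True by (simp add: sum.delta' if_distrib[of "\<lambda>x. _ * x"] cong: if_cong)
  also have "(\<Sum>i<f. m * p * (if j = prev i then 1 else 0)) = (\<Sum>i\<in>prev ` {..<f}. m * p * (if j = i then 1 else 0))"
    by (simp add: sum.reindex[OF inj_on_prev])
  also have "\<dots> \<le> m * p"
    by (simp add: sum.delta' if_distrib[of "\<lambda>x. _ * x"] cong: if_cong)
  finally show ?thesis using True by simp
next
  case False
  then show ?thesis using prev_less by (auto simp: theta_pow_degree_def intro!: sum.neutral)
qed

end

section \<open>Digits\<close>

lemma digit_sum_less: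
  "(\<And>i. i < n \<Longrightarrow> a i < b) \<Longrightarrow> (\<Sum>i<n. a i * b ^ i) < (b::nat) ^ n"
proof (induction n)
  case (Suc n)
  have "(\<Sum>i<n. a i * b ^ i) < b ^ n" "a n + 1 \<le> b" using Suc by (auto simp: Suc_le_eq)
  then have "(\<Sum>i<n. a i * b ^ i) + a n * b ^ n < (a n + 1) * b ^ n" by simp
  also have "\<dots> \<le> b * b ^ n" using \<open>a n + 1 \<le> b\<close> by (rule mult_le_mono1)
  finally show ?case by simp
qed simp

lemma digit_sum_div_mod:
  assumes "\<And>i. i < n \<Longrightarrow> a i < b" "j < n"
  shows "(\<Sum>i<n. a i * b ^ i) div b ^ j mod b = (a j :: nat)"
  using assms
proof (induction n)
  case (Suc n)
  let ?S = "\<Sum>i<n. a i * b ^ i"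
  have b: "b > 0" using Suc.prems(1)[of n] by simp
  show ?case
  proof (cases "j = n")
    case True
    have "?S < b ^ n" by (rule digit_sum_less) (use Suc in auto)
    then show ?thesis using True Suc.prems b by simp
  next
    case False
    then have j: "j < n" using Suc.prems by simp
    then obtain d where d: "n = j + Suc d" using less_imp_Suc_add by fastforce
    have "(?S + a n * b ^ n) div b ^ j = ?S div b ^ j + a n * b ^ Suc d"
      unfolding d power_add using b by (simp add: mult.left_commute[of _ "b ^ j"] del: power_Suc)
    then show ?thesis using Suc j by (simp add: mult.left_commute[of _ b])
  qed
qed simp

lemma digit_sum_digits: "(\<Sum>i<n. k div b ^ i mod b * b ^ i) = (k::nat) mod b ^ n"
proof (induction n)
  case (Suc n)
  have "k mod b ^ Suc n = k mod (b ^ n * b)" by (simp only: power_Suc2)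
  also have "\<dots> = k div b ^ n mod b * b ^ n + k mod b ^ n" unfolding mod_mult2_eq by (simp add: mult.commute)
  finally show ?case using Suc by (simp only: sum.lessThan_Suc add.commute)
qed simp

context finite_field_size
begin

section \<open>Local coordinates at a rational point\<close>

text \<open>
  In the chart \<open>y_i = 1\<close> around \<open>x = 0\<close> the functions \<open>T_i = x_i - x_{i-1}^p\<close> are local coordinates, and solving for
  \<open>x_i\<close> gives the power series \<open>x_i = T_i + T_{i-1}^p + T_{i-2}^{p^2} + \<dots>\<close>. The definition cuts it off after one turn
  of the cycle. Then everything stays polynomial, and the error is only a factor \<open>1 - T_i^{q-1}\<close>. The exponent
  of \<open>p\<close> at \<open>T_l\<close> is the number of steps from \<open>l\<close> forward to \<open>i\<close>. The coordinate \<open>T_l\<close> is represented by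
  the variable \<open>Xvar l\<close>.
\<close>

definition local_subst :: "var \<Rightarrow> 'k mpoly"
  where "local_subst v = (case v of
      Xvar i \<Rightarrow> \<Sum>l<f. Var (Xvar l) ^ (p ^ (if l \<le> i then i - l else i + f - l))
    | Yvar i \<Rightarrow> 1)"

text \<open>
  By additivity of Frobenius, \<open>x_{i-1}^p\<close> has the same terms as \<open>x_i\<close>, except that the term of \<open>T_i\<close> has gone
  around the whole cycle and has become \<open>T_i^q\<close>.
\<close>

lemma local_subst_theta:
  assumes i: "i < f"
  shows "subst local_subst (theta p f i) = Var (Xvar i) * (1 - Var (Xvar i) ^ (q - 1))"
proof -
  define d where "d = (\<lambda>l i. if l \<le> i then i - l else i + f - l)"
  have S: "local_subst (Xvar i) = (\<Sum>l<f. Var (Xvar l) ^ (p ^ d l i))" for i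
    by (simp add: local_subst_def d_def)
  have d: "Suc (d l (prev i)) = (if l = i then f else d l i)" if "l < f" for l
    using that i by (auto simp: d_def prev_def)
  have "local_subst (Xvar (prev i)) ^ p = (\<Sum>l<f. Var (Xvar l) ^ (p ^ Suc (d l (prev i))))"
    by (simp add: S frobenius_mpoly_sum mult.commute flip: power_mult)
  also have "\<dots> = (\<Sum>l<f. Var (Xvar l) ^ (p ^ (if l = i then f else d l i)))"
    by (rule sum.cong) (simp_all only: d lessThan_iff)
  finally have "subst local_subst (theta p f i) =
      (\<Sum>l<f. Var (Xvar l) ^ (p ^ d l i) - Var (Xvar l) ^ (p ^ (if l = i then f else d l i)))"
    by (simp add: theta_eq subst_diff subst_mult subst_power S[of i] sum_subtractf local_subst_def[of "Yvar _"])
  also have "\<dots> = (\<Sum>l<f. if l = i then Var (Xvar i) - Var (Xvar i) ^ q else 0)"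
    by (rule sum.cong) (auto simp: d_def q_def)
  also have "\<dots> = Var (Xvar i) - Var (Xvar i) ^ q"
    using i by simp
  also have "\<dots> = Var (Xvar i) * (1 - Var (Xvar i) ^ (q - 1))"
    using q_gt_1 by (simp add: ring_distribs power_eq_if)
  finally show ?thesis .
qed

definition expo :: "(nat \<Rightarrow> nat) \<Rightarrow> var \<Rightarrow>\<^sub>0 nat"
  where "expo e = (\<Sum>i<f. Poly_Mapping.single (Xvar i) (e i))"

lemma lookup_expo: "i < f \<Longrightarrow> Poly_Mapping.lookup (expo e) (Xvar i) = e i"
  by (simp add: expo_def lookup_sum lookup_single when_def)

text \<open>
  The coefficient of \<open>T^e\<close> in the expansion at the point \<open>(0 : 1)\<close>.
\<close>

definition local_coeff :: "(nat \<Rightarrow> nat) \<Rightarrow> 'k mpoly \<Rightarrow> 'k"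
  where "local_coeff e Q = Poly_Mapping.lookup (subst local_subst Q) (expo e)"

lemma local_coeff_add: "local_coeff e (P + Q) = local_coeff e P + local_coeff e Q"
  by (simp add: local_coeff_def subst_add lookup_add)

lemma local_coeff_sum: "local_coeff e (sum P A) = (\<Sum>i\<in>A. local_coeff e (P i))"
  by (simp add: local_coeff_def subst_sum lookup_sum)

lemma local_coeff_Const_mult: "local_coeff e (Const c * P) = c * local_coeff e P"
  using lookup_single_mult[of 0 c "subst local_subst P" "expo e"]
  by (simp add: local_coeff_def subst_mult Const_def[of c, symmetric])

lemma local_subst_theta_pow:
  "subst local_subst (theta_pow e) =
    Poly_Mapping.single (expo e) 1 * (\<Prod>i<f. (1 - Var (Xvar i) ^ (q - 1)) ^ e i)"
proof -
  have "subst local_subst (theta_pow e) =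
      (\<Prod>i<f. Var (Xvar i) ^ e i) * (\<Prod>i<f. (1 - Var (Xvar i) ^ (q - 1)) ^ e i)"
    by (simp add: theta_pow_def subst_prod subst_power local_subst_theta power_mult_distrib prod.distrib)
  also have "(\<Prod>i<f. Var (Xvar i) ^ e i) = (\<Prod>v\<in>Xvar ` {..<f}. Var v ^ (case v of Xvar i \<Rightarrow> e i | Yvar i \<Rightarrow> 0) :: 'k mpoly)"
    by (simp add: prod.reindex inj_on_def)
  also have "\<dots> = Poly_Mapping.single (expo e) 1"
    by (simp add: prod_Var_power sum.reindex inj_on_def expo_def)
  finally show ?thesis .
qed

text \<open>
  The rational point \<open>(c : d)\<close> in the product of projective lines, as a vector of homogeneous
  coordinates.
\<close>

definition pt :: "'k \<Rightarrow> 'k \<Rightarrow> var \<Rightarrow> 'k"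
  where "pt c d v = (case v of Xvar i \<Rightarrow> c ^ (p ^ i) | Yvar i \<Rightarrow> d ^ (p ^ i))"

lemma pt_simps [simp]: "pt c d (Xvar i) = c ^ (p ^ i)" "pt c d (Yvar i) = d ^ (p ^ i)"
  by (simp_all add: pt_def)

lemma single_Suc_neq_0 [simp]: "Poly_Mapping.single v (Suc n) \<noteq> 0"
  by (metis lookup_single_eq lookup_zero nat.distinct(1))

lemma local_subst_at_0: "(\<lambda>v. Poly_Mapping.lookup (local_subst v) 0) = pt 0 1"
proof
  fix v
  show "Poly_Mapping.lookup (local_subst v) 0 = pt 0 1 v"
    using p_gt_1
    by (cases v) (auto simp: local_subst_def pt_def lookup_sum lookup_power_0 Var_def lookup_single when_def
        power_0_left intro!: sum.neutral)
qed

lemma local_coeff_theta_pow: "local_coeff e (theta_pow e * P) = peval (pt 0 1) P"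
proof -
  have "local_coeff e (theta_pow e * P) =
      Poly_Mapping.lookup ((\<Prod>i<f. (1 - Var (Xvar i) ^ (q - 1)) ^ e i) * subst local_subst P) 0"
    using lookup_single_mult[of "expo e" 1 _ 0]
    by (simp add: local_coeff_def subst_mult local_subst_theta_pow mult.assoc)
  also have "\<dots> = Poly_Mapping.lookup (subst local_subst P) 0"
    using q_gt_1
    by (simp add: lookup_mult_0 lookup_prod_0 lookup_power_0 lookup_minus lookup_single Var_def power_0_left when_def)
  finally show ?thesis by (simp add: lookup_subst_0 local_subst_at_0)
qed

text \<open>
  After the local substitution \<open>theta_pow e'\<close> is divisible by \<open>T^{e'}\<close>, and \<open>T^e\<close> is not a multiple of it.
\<close>

lemma local_coeff_theta_pow_eq_0:
  assumes "i < f" "e i < e' i"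
  shows "local_coeff e (theta_pow e' * P) = 0"
proof -
  have "expo e \<noteq> expo e' + s" for s
  proof
    assume "expo e = expo e' + s"
    then have "Poly_Mapping.lookup (expo e) (Xvar i) = Poly_Mapping.lookup (expo e' + s) (Xvar i)" by simp
    then show False using assms by (simp add: lookup_add lookup_expo)
  qed
  then show ?thesis
    by (simp add: local_coeff_def subst_mult local_subst_theta_pow mult.assoc lookup_single_mult_eq_0)
qed

section \<open>Evaluation at rational points\<close>

lemma peval_act:
  "peval (pt c d) (subst (frob_subst p A) P) =
    peval (pt (c * A$1$1 + d * A$2$1) (c * A$1$2 + d * A$2$2)) P"
proof -
  have "peval (pt c d) (frob_subst p A v) = pt (c * A$1$1 + d * A$2$1) (c * A$1$2 + d * A$2$2) v" for v
    by (cases v) (simp_all add: frobenius_add power_mult_distrib mult.commute)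
  then show ?thesis by (simp add: peval_subst)
qed

lemma peval_V:
  assumes P: "(P :: 'k mpoly) \<in> V_carrier f s"
  shows "peval \<xi> P = (\<Sum>t\<in>Poly_Mapping.keys P. Poly_Mapping.lookup P t *
    (\<Prod>i<f. \<xi> (Xvar i) ^ Poly_Mapping.lookup t (Xvar i) * \<xi> (Yvar i) ^ Poly_Mapping.lookup t (Yvar i)))"
proof -
  have "peval \<xi> (monom_subst Var t) =
     (\<Prod>i<f. \<xi> (Xvar i) ^ Poly_Mapping.lookup t (Xvar i) * \<xi> (Yvar i) ^ Poly_Mapping.lookup t (Yvar i))"
    if t: "t \<in> Poly_Mapping.keys P" for t
  proof -
    have k: "Poly_Mapping.keys t \<subseteq> Xvar ` {..<f} \<union> Yvar ` {..<f}"
    proof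
      fix v assume v: "v \<in> Poly_Mapping.keys t"
      have "Poly_Mapping.lookup t (Xvar i) + Poly_Mapping.lookup t (Yvar i) = (if i < f then s i else 0)" for i
        using P t by (auto simp: V_carrier_def)
      then have z: "Poly_Mapping.lookup t (Xvar i) = 0" "Poly_Mapping.lookup t (Yvar i) = 0" if "\<not> i < f" for i
        using that by (metis add_is_0)+
      show "v \<in> Xvar ` {..<f} \<union> Yvar ` {..<f}"
        using v z by (cases v) (metis UnI1 UnI2 imageI in_keys_iff lessThan_iff)+
    qed
    have "Xvar ` {..<f} \<inter> Yvar ` {..<f} = {}" by auto
    then have "monom_subst Var t = (\<Prod>v\<in>Xvar ` {..<f}. Var v ^ Poly_Mapping.lookup t v) *
        (\<Prod>v\<in>Yvar ` {..<f}. (Var v ^ Poly_Mapping.lookup t v :: 'k mpoly))"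
      by (subst monom_subst_superset[OF _ k]) (simp_all add: prod.union_disjoint)
    then show ?thesis
      by (simp add: peval_prod prod.reindex inj_on_def prod.distrib)
  qed
  then have monom: "Poly_Mapping.lookup P t * peval \<xi> (monom_subst Var t) = Poly_Mapping.lookup P t *
     (\<Prod>i<f. \<xi> (Xvar i) ^ Poly_Mapping.lookup t (Xvar i) * \<xi> (Yvar i) ^ Poly_Mapping.lookup t (Yvar i))" if "t \<in> Poly_Mapping.keys P" for t
    using that by simp
  have "P = (\<Sum>t\<in>Poly_Mapping.keys P. Const (Poly_Mapping.lookup P t) * monom_subst Var t)"
    by (rule trans[OF subst_Var_id[symmetric] subst_superset]) auto
  then have "peval \<xi> P = peval \<xi> (\<Sum>t\<in>Poly_Mapping.keys P. Const (Poly_Mapping.lookup P t) * monom_subst Var t)"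
    by (rule arg_cong)
  also have "\<dots> = (\<Sum>t\<in>Poly_Mapping.keys P. Poly_Mapping.lookup P t * peval \<xi> (monom_subst Var t))"
    by (simp add: peval_sum)
  also have "\<dots> = (\<Sum>t\<in>Poly_Mapping.keys P. Poly_Mapping.lookup P t *
     (\<Prod>i<f. \<xi> (Xvar i) ^ Poly_Mapping.lookup t (Xvar i) * \<xi> (Yvar i) ^ Poly_Mapping.lookup t (Yvar i)))"
    by (rule sum.cong) (simp_all only: monom)
  finally show ?thesis .
qed

text \<open>
  Multi-homogeneity: scaling \<open>(c, d)\<close> by \<open>l\<close> scales the \<open>i\<close>-th pair of coordinates by \<open>l^{p^i}\<close>. The resulting
  power of \<open>l\<close> is the torus part of the inducing character.
\<close>

lemma peval_pt_scale:
  assumes P: "(P :: 'k mpoly) \<in> V_carrier f s"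
  shows "peval (pt (l * c) (l * d)) P = l ^ (\<Sum>i<f. s i * p ^ i) * peval (pt c d) P"
proof -
  have "(\<Prod>i<f. pt (l * c) (l * d) (Xvar i) ^ Poly_Mapping.lookup t (Xvar i) * pt (l * c) (l * d) (Yvar i) ^ Poly_Mapping.lookup t (Yvar i))
    = l ^ (\<Sum>i<f. s i * p ^ i) *
      (\<Prod>i<f. pt c d (Xvar i) ^ Poly_Mapping.lookup t (Xvar i) * pt c d (Yvar i) ^ Poly_Mapping.lookup t (Yvar i))"
    if t: "t \<in> Poly_Mapping.keys P" for t
  proof -
    have "Poly_Mapping.lookup t (Xvar i) + Poly_Mapping.lookup t (Yvar i) = s i" if "i < f" for i
      using P t that by (simp add: V_carrier_def)
    then have "(\<Sum>i<f. s i * p ^ i) = (\<Sum>i<f. p ^ i * Poly_Mapping.lookup t (Xvar i) + p ^ i * Poly_Mapping.lookup t (Yvar i))"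
      by (intro sum.cong) (auto simp: algebra_simps simp flip: distrib_left)
    then show ?thesis
      by (simp add: power_sum power_mult power_add power_mult_distrib prod.distrib mult_ac)
  qed
  then show ?thesis
    by (simp add: peval_V[OF P] sum_distrib_left mult.left_commute)
qed

lemma peval_theta: "i < f \<Longrightarrow> peval (pt c d) (theta p f i) = 0"
  by (simp add: theta_eq frobenius_prev)

section \<open>Subrepresentations of multiples\<close>

lemma V_carrier_closed:
  "(0 :: 'k mpoly) \<in> V_carrier f r" "P \<in> V_carrier f r \<Longrightarrow> Q \<in> V_carrier f r \<Longrightarrow> (P :: 'k mpoly) + Q \<in> V_carrier f r"
  "P \<in> V_carrier f r \<Longrightarrow> Q \<in> V_carrier f r \<Longrightarrow> P - Q \<in> V_carrier f r"
  "P \<in> V_carrier f r \<Longrightarrow> Const c * P \<in> V_carrier f r"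
  "P \<in> V_carrier f r \<Longrightarrow> subst (frob_subst p A) P \<in> V_carrier f r"
  by (auto simp: V_carrier_eq homogeneous_add homogeneous_diff homogeneous_Const_mult homogeneous_frob_subst)

lemma V_carrier_sum: "(\<And>i. i \<in> A \<Longrightarrow> (P i :: 'k mpoly) \<in> V_carrier f r) \<Longrightarrow> sum P A \<in> V_carrier f r"
  by (simp add: V_carrier_eq homogeneous_sum)

lemma multiples_closed:
  fixes g P Q :: "'k mpoly"
  shows "0 \<in> multiples f r g" "P \<in> multiples f r g \<Longrightarrow> Q \<in> multiples f r g \<Longrightarrow> P + Q \<in> multiples f r g"
  "P \<in> multiples f r g \<Longrightarrow> Q \<in> multiples f r g \<Longrightarrow> P - Q \<in> multiples f r g"
  "P \<in> multiples f r g \<Longrightarrow> Const c * P \<in> multiples f r g"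
  by (auto simp: multiples_def V_carrier_closed)

lemma multiples_act:
  assumes "P \<in> multiples f r (theta_pow e)"
  shows "subst (frob_subst p A) P \<in> multiples f r (theta_pow e)"
proof -
  obtain Q where Q: "P = theta_pow e * Q" using assms by (auto simp: multiples_def elim: dvdE)
  have "subst (frob_subst p A) P = theta_pow e * (Const (det A ^ (\<Sum>i<f. e i * p ^ i)) * subst (frob_subst p A) Q)"
    by (simp add: Q subst_mult theta_pow_semi_invariant mult_ac)
  then have "theta_pow e dvd subst (frob_subst p A) P" by (rule dvdI)
  then show ?thesis using assms by (simp add: multiples_def V_carrier_closed)
qed

lemma V_sub_closed:
  fixes P Q :: "'k mpoly"
  shows "(0 :: 'k mpoly) \<in> V_sub p f r k" "P \<in> V_sub p f r k \<Longrightarrow> Q \<in> V_sub p f r k \<Longrightarrow> P + Q \<in> V_sub p f r k"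
  "P \<in> V_sub p f r k \<Longrightarrow> Const c * P \<in> V_sub p f r k"
  "P \<in> V_sub p f r k \<Longrightarrow> subst (frob_subst p A) P \<in> V_sub p f r k"
  "P \<in> V_sub p f r k \<Longrightarrow> P \<in> V_carrier f r"
proof -
  show "(0 :: 'k mpoly) \<in> V_sub p f r k" unfolding V_sub_def
    by (rule CollectI, rule exI[of _ "\<lambda>_. 0"]) (auto simp: multiples_closed)
  show "P + Q \<in> V_sub p f r k" if "P \<in> V_sub p f r k" "Q \<in> V_sub p f r k"
  proof -
    obtain u where "P = (\<Sum>i<f. u i)" "\<forall>i<f. u i \<in> multiples f r (theta p f i ^ k)"
      using \<open>P \<in> V_sub p f r k\<close> unfolding V_sub_def by blast
    moreover obtain w where "Q = (\<Sum>i<f. w i)" "\<forall>i<f. w i \<in> multiples f r (theta p f i ^ k)"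
      using \<open>Q \<in> V_sub p f r k\<close> unfolding V_sub_def by blast
    ultimately show ?thesis unfolding V_sub_def
      by (intro CollectI exI[of _ "\<lambda>i. u i + w i"]) (auto simp: multiples_closed sum.distrib)
  qed
  assume "P \<in> V_sub p f r k"
  then obtain u where u: "P = (\<Sum>i<f. u i)" "\<forall>i<f. u i \<in> multiples f r (theta p f i ^ k)"
    by (auto simp: V_sub_def)
  show "Const c * P \<in> V_sub p f r k" unfolding V_sub_def
    by (intro CollectI exI[of _ "\<lambda>i. Const c * u i"]) (use u in \<open>auto simp: multiples_closed sum_distrib_left\<close>)
  show "subst (frob_subst p A) P \<in> V_sub p f r k" unfolding V_sub_def
    by (intro CollectI exI[of _ "\<lambda>i. subst (frob_subst p A) (u i)"])
      (use u in \<open>auto simp: multiples_act subst_sum theta_power_eq\<close>)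
  show "P \<in> V_carrier f r" using u by (auto intro!: V_carrier_sum simp: multiples_def)
qed

lemma V_sub_sum: "(\<And>i. i \<in> A \<Longrightarrow> (P i :: 'k mpoly) \<in> V_sub p f r k) \<Longrightarrow> sum P A \<in> V_sub p f r k"
  by (induction A rule: infinite_finite_induct) (auto simp: V_sub_closed)

lemma multiples_subset_V_sub:
  assumes "i < f" "P \<in> multiples f r (theta p f i ^ k)"
  shows "(P :: 'k mpoly) \<in> V_sub p f r k"
  unfolding V_sub_def
  by (intro CollectI exI[of _ "\<lambda>j. if j = i then P else 0"]) (use assms in \<open>auto simp: multiples_closed\<close>)


section \<open>Polynomials vanishing at the rational points\<close>

text \<open>
  For \<open>p \<le> s_i\<close> these are the exponents on which no carry \<open>x_{i-1}^p y_i \<mapsto> x_i y_{i-1}^p\<close> is possible: \<open>q\<close> digit vectors and the pure power of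
  the \<open>x_i\<close>.
\<close>

definition normal_exponent :: "(nat \<Rightarrow> nat) \<Rightarrow> (var \<Rightarrow>\<^sub>0 nat) \<Rightarrow> bool"
  where "normal_exponent s t \<longleftrightarrow>
    multidegree t = (\<lambda>i. if i < f then s i else 0) \<and>
    ((\<forall>i<f. Poly_Mapping.lookup t (Xvar i) < p) \<or> (\<forall>i<f. Poly_Mapping.lookup t (Xvar i) = s i))"

lemma prev_induct:
  assumes step: "\<And>i. i < f \<Longrightarrow> Q i \<Longrightarrow> Q (prev i)" and j: "j < f" "Q j" and i: "i < f"
  shows "Q i"
proof -
  have down: "Q (a - n)" if "Q a" "a < f" for a n
  proof (induction n)
    case (Suc n)
    then show ?case
      using step[of "a - n"] \<open>a < f\<close> by (cases "a \<le> n") (simp_all add: prev_def)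
  qed (use that in simp)
  have "Q 0" using down[of j j] j by simp
  then have "Q (f - 1)" using step[of 0] f_pos by (simp add: prev_def)
  then show ?thesis using down[of "f - 1" "f - 1 - i"] i by simp
qed

text \<open>
  Suppose that no carry is possible. If some \<open>x\<close>-exponent is less than \<open>p\<close>, then its \<open>y\<close>-exponent is
  positive because the total degree is at least \<open>p\<close>, so the preceding \<open>x\<close>-exponent is less than \<open>p\<close> as
  well, and this propagates around the cycle. Otherwise all \<open>y\<close>-exponents are \<open>0\<close>.
\<close>

lemma exists_carry:
  assumes s: "\<And>i. i < f \<Longrightarrow> p \<le> s i" and deg: "multidegree t = (\<lambda>i. if i < f then s i else 0)"
    and not_normal: "\<not> normal_exponent s t"
  shows "\<exists>i<f. p \<le> Poly_Mapping.lookup t (Xvar (prev i)) \<and> 1 \<le> Poly_Mapping.lookup t (Yvar i)"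
proof (rule ccontr)
  assume "\<not> ?thesis"
  then have no: "Poly_Mapping.lookup t (Xvar (prev i)) < p \<or> Poly_Mapping.lookup t (Yvar i) = 0" if "i < f" for i
    using that by (metis One_nat_def Suc_leI not_gr_zero not_le)
  have d: "Poly_Mapping.lookup t (Xvar i) + Poly_Mapping.lookup t (Yvar i) = s i" if "i < f" for i
    using that fun_cong[OF deg, of i] by (simp add: multidegree_def)
  show False
  proof (cases "\<exists>j<f. Poly_Mapping.lookup t (Xvar j) < p")
    case True
    then obtain j where j: "j < f" "Poly_Mapping.lookup t (Xvar j) < p" by auto
    have "Poly_Mapping.lookup t (Xvar i) < p" if "i < f" for i
    proof (rule prev_induct[where Q = "\<lambda>i. Poly_Mapping.lookup t (Xvar i) < p" and j = j, OF _ j that])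
      fix i assume i: "i < f" "Poly_Mapping.lookup t (Xvar i) < p"
      then have "Poly_Mapping.lookup t (Yvar i) \<noteq> 0" using d[of i] s[of i] by auto
      then show "Poly_Mapping.lookup t (Xvar (prev i)) < p" using no[of i] i by auto
    qed
    then show False using not_normal deg by (simp add: normal_exponent_def)
  next
    case False
    have "Poly_Mapping.lookup t (Xvar i) = s i" if "i < f" for i
      using no[OF that] False prev_less[OF that] d[OF that] by auto
    then show False using not_normal deg by (simp add: normal_exponent_def)
  qed
qed

text \<open>
  The two monomials of \<open>\<theta>_i\<close> have the same multidegree, but total \<open>x\<close>-degrees \<open>1\<close> and \<open>p\<close>. So a carry changes
  the monomial by a multiple of \<open>\<theta>_i\<close> and lowers its \<open>x\<close>-degree, which makes the reduction terminate.
\<close>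

lemma carry_monomial:
  assumes i: "i < f" and X: "p \<le> Poly_Mapping.lookup t (Xvar (prev i))"
    and Y: "1 \<le> Poly_Mapping.lookup t (Yvar i)"
  shows "\<exists>t'. multidegree t' = multidegree t
    \<and> (\<Sum>l<f. Poly_Mapping.lookup t' (Xvar l)) < (\<Sum>l<f. Poly_Mapping.lookup t (Xvar l))
    \<and> (\<forall>c. theta p f i dvd (Poly_Mapping.single t c - Poly_Mapping.single t' c :: 'k mpoly))"
proof -
  define a where "a = Poly_Mapping.single (Xvar (prev i)) p + Poly_Mapping.single (Yvar i) (1::nat)"
  define b where "b = Poly_Mapping.single (Xvar i) (1::nat) + Poly_Mapping.single (Yvar (prev i)) p"
  define u where "u = t - a"
  have t: "t = u + a"
  proof (rule poly_mapping_eqI)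
    fix v
    have "Poly_Mapping.lookup a v \<le> Poly_Mapping.lookup t v"
      using X Y by (auto simp: a_def lookup_add lookup_single when_def)
    then show "Poly_Mapping.lookup t v = Poly_Mapping.lookup (u + a) v"
      by (simp add: u_def lookup_add minus_poly_mapping.rep_eq)
  qed
  have deg: "multidegree a = multidegree b"
    by (auto simp: a_def b_def multidegree_def lookup_add lookup_single when_def)
  have "(\<Sum>l<f. Poly_Mapping.lookup a (Xvar l)) = p" "(\<Sum>l<f. Poly_Mapping.lookup b (Xvar l)) = 1"
    using i prev_less[OF i] by (simp_all add: a_def b_def lookup_add lookup_single when_def)
  then have sum: "(\<Sum>l<f. Poly_Mapping.lookup (u + b) (Xvar l)) < (\<Sum>l<f. Poly_Mapping.lookup t (Xvar l))"
    using p_gt_1 unfolding t by (simp add: lookup_add sum.distrib)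
  have "Poly_Mapping.single t c - Poly_Mapping.single (u + b) c = theta p f i * - Poly_Mapping.single u c"
    for c :: 'k
  proof -
    have th: "theta p f i = Poly_Mapping.single b 1 - (Poly_Mapping.single a 1 :: 'k mpoly)"
      by (simp add: theta_eq Var_power a_def b_def mult_single) (simp add: Var_def mult_single add.commute)
    show ?thesis by (simp add: t th ring_distribs mult_single add.commute)
  qed
  then show ?thesis
    using sum deg t by (intro exI[of _ "u + b"]) (auto simp: multidegree_add)
qed

lemma reduce_monomial:
  assumes s: "\<And>i. i < f \<Longrightarrow> p \<le> s i" and deg: "multidegree t = (\<lambda>i. if i < f then s i else 0)"
  shows "\<exists>t'. normal_exponent s t' \<and>
    (\<forall>c. (Poly_Mapping.single t c - Poly_Mapping.single t' c :: 'k mpoly) \<in> V_sub p f s 1)"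
  using deg
proof (induction "\<Sum>l<f. Poly_Mapping.lookup t (Xvar l)" arbitrary: t rule: less_induct)
  case less
  show ?case
  proof (cases "normal_exponent s t")
    case True
    then show ?thesis by (intro exI[of _ t]) (simp add: V_sub_closed)
  next
    case False
    then obtain i where i: "i < f" "p \<le> Poly_Mapping.lookup t (Xvar (prev i))" "1 \<le> Poly_Mapping.lookup t (Yvar i)"
      using exists_carry[OF s less.prems] by blast
    then obtain t1 where t1: "multidegree t1 = multidegree t"
        "(\<Sum>l<f. Poly_Mapping.lookup t1 (Xvar l)) < (\<Sum>l<f. Poly_Mapping.lookup t (Xvar l))"
        "\<And>c. theta p f i dvd (Poly_Mapping.single t c - Poly_Mapping.single t1 c :: 'k mpoly)"
      using carry_monomial by metis
    have d1: "multidegree t1 = (\<lambda>i. if i < f then s i else 0)" using t1(1) less.prems by simp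
    obtain t' where t': "normal_exponent s t'"
        "\<And>c. (Poly_Mapping.single t1 c - Poly_Mapping.single t' c :: 'k mpoly) \<in> V_sub p f s 1"
      using less.hyps[OF t1(2) d1] by blast
    have "(Poly_Mapping.single t c - Poly_Mapping.single t' c :: 'k mpoly) \<in> V_sub p f s 1" for c
    proof -
      have "Poly_Mapping.single u c \<in> V_carrier f s" if "multidegree u = (\<lambda>i. if i < f then s i else 0)" for u
        using homogeneous_single[of u c] that by (simp add: V_carrier_eq)
      then have "(Poly_Mapping.single t c - Poly_Mapping.single t1 c :: 'k mpoly) \<in> multiples f s (theta p f i ^ 1)"
        using t1(3) less.prems d1 by (simp add: multiples_def V_carrier_closed)
      from V_sub_closed(2)[OF multiples_subset_V_sub[OF i(1) this] t'(2)[of c]] show ?thesis by simp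
    qed
    then show ?thesis using t'(1) by blast
  qed
qed

lemma peval_V_sub:
  assumes P: "(P :: 'k mpoly) \<in> V_sub p f s 1"
  shows "peval (pt c d) P = 0"
proof -
  obtain u where u: "P = (\<Sum>i<f. u i)" "\<And>i. i < f \<Longrightarrow> u i \<in> multiples f s (theta p f i ^ 1)"
    using P unfolding V_sub_def by blast
  have "peval (pt c d) (u i) = 0" if "i < f" for i
    using u(2)[OF that] peval_theta[OF that] by (auto simp: multiples_def elim!: dvdE)
  then show ?thesis by (simp add: u(1) peval_sum)
qed

text \<open>
  The value at \<open>(1 : 0)\<close> is the coefficient of the pure power of the \<open>x_i\<close>. At \<open>(z : 1)\<close> a digit vector \<open>a\<close>
  takes the value \<open>z\<close> to the power \<open>\<Sum>_i a_i p^i\<close>; these powers are distinct and less than \<open>q\<close>, so the values at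
  \<open>(z : 1)\<close> are those of a polynomial in \<open>z\<close> of degree less than \<open>q\<close> with the same coefficients.
\<close>

lemma normal_polynomial_eq_0:
  assumes keys: "\<And>t. t \<in> Poly_Mapping.keys P \<Longrightarrow> normal_exponent s t"
    and vanish: "\<And>c d. c \<noteq> 0 \<or> d \<noteq> 0 \<Longrightarrow> peval (pt c d) P = (0::'k)"
  shows "P = 0"
proof -
  let ?lk = "Poly_Mapping.lookup"
  have P: "P \<in> V_carrier f s" using keys by (auto simp: V_carrier_eq homogeneous_def normal_exponent_def)
  have deg: "?lk t (Xvar i) + ?lk t (Yvar i) = (if i < f then s i else 0)" if "t \<in> Poly_Mapping.keys P" for t i
    using P that by (auto simp: V_carrier_def)
  have eqI: "t = t'" if t: "t \<in> Poly_Mapping.keys P" "t' \<in> Poly_Mapping.keys P"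
    and X: "\<And>i. i < f \<Longrightarrow> ?lk t (Xvar i) = ?lk t' (Xvar i)" for t t'
  proof (rule poly_mapping_eqI)
    fix v
    have "?lk t (Xvar i) = ?lk t' (Xvar i) \<and> ?lk t (Yvar i) = ?lk t' (Yvar i)" for i
      using deg[OF t(1), of i] deg[OF t(2), of i] X[of i] by (cases "i < f") auto
    then show "?lk t v = ?lk t' v" by (cases v) auto
  qed
  have small: "?lk t (Xvar i) < p" if t: "t \<in> Poly_Mapping.keys P" and i: "i < f" for t i
  proof (rule ccontr)
    assume "\<not> ?thesis"
    then have full: "?lk t (Xvar i) = s i" if "i < f" for i
      using keys[OF t] i that by (auto simp: normal_exponent_def)
    have prod: "(\<Prod>i<f. pt 1 0 (Xvar i) ^ ?lk u (Xvar i) * pt 1 0 (Yvar i) ^ ?lk u (Yvar i)) = (if u = t then 1 else (0::'k))"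
      if u: "u \<in> Poly_Mapping.keys P" for u
    proof (cases "u = t")
      case True
      have "?lk t (Yvar i) = 0" if "i < f" for i using deg[OF t, of i] full[OF that] that by simp
      then show ?thesis using True by simp
    next
      case False
      then obtain j where j: "j < f" "?lk u (Xvar j) \<noteq> s j" using eqI[OF u t] full by auto
      then have "?lk u (Yvar j) > 0" using deg[OF u, of j] by auto
      then have "pt 1 0 (Xvar j) ^ ?lk u (Xvar j) * pt 1 0 (Yvar j) ^ ?lk u (Yvar j) = (0::'k)"
        using p_gt_1 by (simp add: power_0_left)
      then show ?thesis using False j(1) by (auto intro!: prod_zero)
    qed
    have "peval (pt 1 0) P = (\<Sum>u\<in>Poly_Mapping.keys P. ?lk P u * (if u = t then 1 else 0))"
      unfolding peval_V[OF P] by (rule sum.cong) (simp_all only: prod)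
    also have "\<dots> = ?lk P t" using t by (simp add: if_distrib[of "\<lambda>x. _ * x"] cong: if_cong)
    finally show False using vanish[of 1 0] t by (simp add: in_keys_iff)
  qed
  define code where "code = (\<lambda>t. \<Sum>i<f. ?lk t (Xvar i) * p ^ i)"
  have inj: "inj_on code (Poly_Mapping.keys P)"
  proof (rule inj_onI)
    fix t t' assume t: "t \<in> Poly_Mapping.keys P" "t' \<in> Poly_Mapping.keys P" "code t = code t'"
    have "?lk t (Xvar i) = ?lk t' (Xvar i)" if "i < f" for i
      using digit_sum_div_mod[of f "\<lambda>i. ?lk t (Xvar i)" p i] digit_sum_div_mod[of f "\<lambda>i. ?lk t' (Xvar i)" p i]
        small t that by (simp add: code_def)
    then show "t = t'" using eqI t by blast
  qed
  define R where "R = (\<Sum>t\<in>Poly_Mapping.keys P. Polynomial.monom (?lk P t) (code t))"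
  have "poly R z = peval (pt z 1) P" for z
    by (simp add: R_def peval_V[OF P] poly_sum poly_monom code_def power_sum mult.commute[of "?lk _ (Xvar _)"] power_mult)
  then have roots: "{z. poly R z = 0} = UNIV" using vanish[of _ 1] by auto
  have "Polynomial.degree R \<le> q - 1"
    unfolding R_def
  proof (rule degree_sum_le)
    fix t assume t: "t \<in> Poly_Mapping.keys P"
    have "code t < q" unfolding code_def q_def by (rule digit_sum_less) (use small t in auto)
    then show "Polynomial.degree (Polynomial.monom (?lk P t) (code t)) \<le> q - 1"
      using degree_monom_le[of "?lk P t" "code t"] by simp
  qed simp
  then have "R = 0" using card_poly_roots_bound[of R] roots card_k q_gt_1 by fastforce
  show "P = 0"
  proof (rule ccontr)
    assume "P \<noteq> 0"
    then obtain t where t: "t \<in> Poly_Mapping.keys P" by (metis keys_eq_empty ex_in_conv)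
    have "Polynomial.coeff R (code t) = (\<Sum>u\<in>Poly_Mapping.keys P. if u = t then ?lk P u else 0)"
      unfolding R_def coeff_sum
      by (rule sum.cong) (use inj t in \<open>auto simp: inj_on_def\<close>)
    also have "\<dots> = ?lk P t" using t by simp
    finally show False using \<open>R = 0\<close> t by (simp add: in_keys_iff)
  qed
qed

text \<open>
  The common zero locus of the \<open>\<theta>_i\<close> is reduced: forms that vanish on it are combinations of the \<open>\<theta>_i\<close>.
\<close>

lemma vanishing_imp_V_sub:
  assumes s: "\<And>i. i < f \<Longrightarrow> p \<le> s i" and P: "(P :: 'k mpoly) \<in> V_carrier f s"
    and vanish: "\<And>c d. c \<noteq> 0 \<or> d \<noteq> 0 \<Longrightarrow> peval (pt c d) P = 0"
  shows "P \<in> V_sub p f s 1"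
proof -
  have "\<exists>t'. normal_exponent s t' \<and>
      (\<forall>c. (Poly_Mapping.single t c - Poly_Mapping.single t' c :: 'k mpoly) \<in> V_sub p f s 1)"
    if "t \<in> Poly_Mapping.keys P" for t
    by (rule reduce_monomial[OF s]) (use P that in \<open>auto simp: V_carrier_eq homogeneous_def\<close>)
  then obtain n where n: "\<And>t. t \<in> Poly_Mapping.keys P \<Longrightarrow> normal_exponent s (n t)"
      "\<And>t c. t \<in> Poly_Mapping.keys P \<Longrightarrow>
        (Poly_Mapping.single t c - Poly_Mapping.single (n t) c :: 'k mpoly) \<in> V_sub p f s 1"
    by metis
  define N where "N = (\<Sum>t\<in>Poly_Mapping.keys P. Poly_Mapping.single (n t) (Poly_Mapping.lookup P t))"
  have "P - N = (\<Sum>t\<in>Poly_Mapping.keys P. Poly_Mapping.single t (Poly_Mapping.lookup P t)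
      - Poly_Mapping.single (n t) (Poly_Mapping.lookup P t))"
    by (simp add: N_def sum_subtractf mpoly_sum_monomials[symmetric])
  then have PN: "P - N \<in> V_sub p f s 1" by (simp only:) (intro V_sub_sum n(2))
  have "N = 0"
  proof (rule normal_polynomial_eq_0)
    fix t assume "t \<in> Poly_Mapping.keys N"
    then show "normal_exponent s t"
      using n(1) keys_sum by (fastforce simp: N_def in_keys_iff lookup_sum lookup_single when_def
          elim!: sum.not_neutral_contains_not_neutral split: if_splits)
  next
    fix c d :: 'k assume "c \<noteq> 0 \<or> d \<noteq> 0"
    then show "peval (pt c d) N = 0" using vanish[of c d] peval_V_sub[OF PN, of c d] by simp
  qed
  then show ?thesis using PN by simp
qed

section \<open>Interpolation at the rational points\<close>

text \<open>
  The indicator function of \<open>(0 : 1)\<close> is the value of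
  \<open>\<Prod>_i y_i^{s_i} - \<Prod>_i x_i^{p-1} y_i^{s_i-p+1}\<close>, since the \<open>x\<close>-part of the second monomial evaluates to \<open>c^{q-1}\<close> at
  \<open>(c : d)\<close>. The group moves \<open>(0 : 1)\<close> to every other rational point.
\<close>

lemma interpolation:
  assumes s: "\<And>i. i < f \<Longrightarrow> p \<le> s i"
  shows "\<exists>P \<in> V_carrier f s. (\<forall>z::'k. peval (pt z 1) P = v z) \<and> peval (pt 1 0) P = w"
proof -
  define Y where "Y = (\<Prod>i<f. Var (Yvar i) ^ s i :: 'k mpoly)"
  define M where "M = (\<Prod>i<f. Var (Xvar i) ^ (p - 1) * Var (Yvar i) ^ (s i - (p - 1)) :: 'k mpoly)"
  have *: "(\<lambda>j. \<Sum>i<f. s i * (if j = i then 1 else 0)) = (\<lambda>j. if j < f then s j else 0)"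
    by (auto simp: if_distrib[of "\<lambda>x. _ * x"] cong: if_cong)
  have "Y \<in> homogeneous (\<lambda>j. \<Sum>i<f. s i * (if j = i then 1 else 0))"
    unfolding Y_def by (intro homogeneous_prod homogeneous_power homogeneous_Var)
  then have Y: "Y \<in> V_carrier f s" by (simp only: * V_carrier_eq)
  have "M \<in> homogeneous (\<lambda>j. \<Sum>i<f. (p - 1) * (if j = i then 1 else 0) + (s i - (p - 1)) * (if j = i then 1 else 0))"
    unfolding M_def by (intro homogeneous_prod homogeneous_mult homogeneous_power homogeneous_Var)
  moreover have "(\<lambda>j. \<Sum>i<f. (p - 1) * (if j = i then 1 else 0) + (s i - (p - 1)) * (if j = i then 1 else 0))
      = (\<lambda>j. \<Sum>i<f. s i * (if j = i then 1 else 0))"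
  proof (intro ext sum.cong refl)
    fix i j assume "i \<in> {..<f}"
    then have "p - 1 + (s i - (p - 1)) = s i" using s[of i] by simp
    then show "(p - 1) * (if j = i then 1 else 0) + (s i - (p - 1)) * (if j = i then 1 else 0)
      = s i * (if j = i then 1 else 0)" by (metis add_mult_distrib)
  qed
  ultimately have M: "M \<in> V_carrier f s" by (simp only: * V_carrier_eq)
  have geometric: "(\<Sum>i<f. p ^ i * (p - 1)) = q - 1"
  proof -
    have "(\<Sum>i<n. p ^ i * (p - 1)) + 1 = p ^ n" for n
    proof (induction n)
      case (Suc n)
      have "p ^ n * (p - 1) + p ^ n = p ^ Suc n" using p_gt_1 by (simp add: algebra_simps)
      then show ?case using Suc by simp
    qed simp
    from this[of f] show ?thesis by (simp add: q_def)
  qed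
  define D where "D = Y - M"
  have D: "D \<in> V_carrier f s" using M Y by (simp add: D_def V_carrier_closed)
  have D0: "peval (pt 0 1) D = 1"
    using p_gt_1 f_pos
    by (auto simp: D_def M_def Y_def peval_prod power_0_left intro!: prod_zero bexI[of _ 0])
  have D1: "peval (pt c d) D = 0" if c: "c \<noteq> 0" for c d
  proof -
    have pow: "(\<Prod>i<f. (x ^ p ^ i) ^ (p - 1)) = x ^ (q - 1)" for x :: 'k
      unfolding power_mult[symmetric] power_sum[symmetric] geometric ..
    have M1: "peval (pt c d) M = (\<Prod>i<f. (d ^ p ^ i) ^ (s i - (p - 1)))"
    proof -
      have "peval (pt c d) M = (\<Prod>i<f. (c ^ p ^ i) ^ (p - 1)) * (\<Prod>i<f. (d ^ p ^ i) ^ (s i - (p - 1)))"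
        by (simp add: M_def peval_prod prod.distrib)
      then show ?thesis by (simp only: pow power_q_minus_1[OF c] mult_1)
    qed
    have "peval (pt c d) Y = (\<Prod>i<f. (d ^ p ^ i) ^ (p - 1) * (d ^ p ^ i) ^ (s i - (p - 1)))"
      unfolding Y_def peval_prod
    proof (rule prod.cong)
      fix i assume "i \<in> {..<f}"
      then have "s i = p - 1 + (s i - (p - 1))" using s[of i] by simp
      then show "peval (pt c d) (Var (Yvar i) ^ s i) = (d ^ p ^ i) ^ (p - 1) * (d ^ p ^ i) ^ (s i - (p - 1))"
        by (metis peval_simps(4,8) power_add pt_simps(2))
    qed simp
    then have Y1: "peval (pt c d) Y = d ^ (q - 1) * (\<Prod>i<f. (d ^ p ^ i) ^ (s i - (p - 1)))"
      by (simp only: prod.distrib pow)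
    show ?thesis
    proof (cases "d = 0")
      case True
      have "(0 ^ p ^ 0) ^ (s 0 - (p - 1)) = (0::'k)" using s[of 0] f_pos p_gt_1 by (simp add: power_0_left)
      then have "(\<Prod>i<f. (d ^ p ^ i) ^ (s i - (p - 1))) = 0"
        using f_pos True by (intro prod_zero) auto
      then show ?thesis using M1 Y1 by (simp add: D_def)
    next
      case False
      then show ?thesis using M1 Y1 power_q_minus_1[OF False] by (simp add: D_def)
    qed
  qed
  \<comment> \<open>\<open>N z\<close> moves \<open>(z : 1)\<close> to \<open>(0 : 1)\<close>, and \<open>W\<close> moves \<open>(1 : 0)\<close> there.\<close>
  define N :: "'k \<Rightarrow> 'k^2^2" where "N = (\<lambda>z. vector [vector [1, 0], vector [-z, 1]])"
  define W :: "'k^2^2" where "W = vector [vector [0, 1], vector [1, 0]]"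
  define P where "P = (\<Sum>z\<in>UNIV. Const (v z) * subst (frob_subst p (N z)) D) + Const w * subst (frob_subst p W) D"
  have "P \<in> V_carrier f s" unfolding P_def by (intro V_carrier_closed V_carrier_sum D)
  moreover have "peval (pt z 1) P = v z" for z
  proof -
    have "peval (pt z 1) P = (\<Sum>z'\<in>UNIV. v z' * peval (pt (z - z') 1) D) + w * peval (pt 1 z) D"
      by (simp add: P_def peval_sum peval_act N_def W_def)
    also have "(\<Sum>z'\<in>UNIV. v z' * peval (pt (z - z') 1) D) = (\<Sum>z'\<in>UNIV. if z' = z then v z' else 0)"
      by (rule sum.cong) (auto simp: D0 D1)
    finally show ?thesis by (simp add: D1)
  qed
  moreover have "peval (pt 1 0) P = w"
    by (simp add: P_def peval_sum peval_act N_def W_def D0 D1)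
  ultimately show ?thesis by blast
qed


section \<open>The filtration by powers of the Dickson polynomials\<close>

text \<open>
  The numbers below \<open>(m + 1)^f\<close> enumerate the exponent vectors with entries at most \<open>m\<close> by their base
  \<open>m + 1\<close> digits. The order of the numbers extends the componentwise order of the vectors.
\<close>

definition digits :: "nat \<Rightarrow> nat \<Rightarrow> nat \<Rightarrow> nat"
  where "digits m k i = k div (m + 1) ^ i mod (m + 1)"

lemma digits_le: "digits m k i \<le> m"
proof -
  have "digits m k i < m + 1" unfolding digits_def by (rule mod_less_divisor) simp
  then show ?thesis by simp
qed

text \<open>
  A number is monotone in its digits.
\<close>

lemma digits_less_if_less:
  assumes "k < l" "l < (m + 1) ^ f"
  shows "\<exists>i<f. digits m k i < digits m l i"
proof (rule ccontr)
  assume "\<not> ?thesis"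
  then have "(\<Sum>i<f. digits m l i * (m + 1) ^ i) \<le> (\<Sum>i<f. digits m k i * (m + 1) ^ i)"
    by (intro sum_mono mult_le_mono1) (meson lessThan_iff not_less)
  then show False using assms unfolding digits_def digit_sum_digits by simp
qed

lemma digits_Suc_at:
  assumes i: "i < f" and k: "k < (m + 1) ^ f" and lt: "digits m k i < m"
  shows "\<exists>l>k. l < (m + 1) ^ f \<and> (\<forall>j<f. digits m l j = digits m k j + (if j = i then 1 else 0))"
proof -
  let ?a = "\<lambda>j. digits m k j + (if j = i then 1 else 0)"
  have a: "?a j < m + 1" for j using lt digits_le[of m k j] by (auto simp: less_Suc_eq_le)
  let ?l = "\<Sum>j<f. ?a j * (m + 1) ^ j"
  have "?l = (\<Sum>j<f. digits m k j * (m + 1) ^ j) + (\<Sum>j<f. if j = i then (m + 1) ^ i else 0)"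
    unfolding sum.distrib[symmetric] by (rule sum.cong) auto
  also have "\<dots> = k + (m + 1) ^ i"
    using k i unfolding digits_def digit_sum_digits by simp
  finally have "k < ?l" by simp
  moreover have "?l < (m + 1) ^ f" by (rule digit_sum_less) (rule a)
  moreover have "digits m ?l j = ?a j" if "j < f" for j
    unfolding digits_def[of m ?l] by (rule digit_sum_div_mod) (use a that in auto)
  ultimately show ?thesis by blast
qed

text \<open>
  Exponent vectors are used in decreasing order, so that multiplying the newest \<open>\<theta>^e\<close> by any \<open>\<theta>_i\<close> leads
  into the preceding step.
\<close>

primrec filtration :: "(nat \<Rightarrow> nat) \<Rightarrow> nat \<Rightarrow> nat \<Rightarrow> 'k mpoly set" where
  "filtration r m 0 = V_sub p f r (m + 1)"
| "filtration r m (Suc j) =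
    {u + w | u w. u \<in> filtration r m j \<and> w \<in> multiples f r (theta_pow (digits m ((m + 1) ^ f - 1 - j)))}"

lemma filtration_SucI:
  "u \<in> filtration r m j \<Longrightarrow> w \<in> multiples f r (theta_pow (digits m ((m + 1) ^ f - 1 - j)))
    \<Longrightarrow> u + w \<in> filtration r m (Suc j)"
  unfolding filtration.simps by blast

lemma filtration_closed:
  "0 \<in> filtration r m j"
  "P \<in> filtration r m j \<Longrightarrow> Q \<in> filtration r m j \<Longrightarrow> P + Q \<in> filtration r m j"
  "P \<in> filtration r m j \<Longrightarrow> Const c * P \<in> filtration r m j"
  "P \<in> filtration r m j \<Longrightarrow> subst (frob_subst p A) P \<in> filtration r m j"
  "P \<in> filtration r m j \<Longrightarrow> P \<in> V_carrier f r"
proof (induction j arbitrary: P Q)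
  case (Suc j)
  let ?M = "multiples f r (theta_pow (digits m ((m + 1) ^ f - 1 - j)))"
  note I = filtration_SucI[of _ r m j]
  {
    case 1
    show ?case using I[OF Suc.IH(1) multiples_closed(1)] by simp
  next
    case 2
    then obtain u w u' w' where *: "P = u + w" "Q = u' + w'" "u \<in> filtration r m j" "w \<in> ?M"
      "u' \<in> filtration r m j" "w' \<in> ?M" by auto
    have "P + Q = (u + u') + (w + w')" using * by (simp add: algebra_simps)
    also have "\<dots> \<in> filtration r m (Suc j)" by (intro I Suc.IH(2) multiples_closed(2) *)
    finally show ?case .
  next
    case 3
    then obtain u w where *: "P = u + w" "u \<in> filtration r m j" "w \<in> ?M" by auto
    then show ?case using I[of "Const c * u" "Const c * w"] Suc.IH(3) multiples_closed(4)
      by (simp add: ring_distribs)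
  next
    case 4
    then obtain u w where *: "P = u + w" "u \<in> filtration r m j" "w \<in> ?M" by auto
    then show ?case using I[of "subst (frob_subst p A) u" "subst (frob_subst p A) w"] Suc.IH(4) multiples_act
      by (simp add: subst_add)
  next
    case 5
    then obtain u w where *: "P = u + w" "u \<in> filtration r m j" "w \<in> ?M" by auto
    then show ?case using Suc.IH(5) V_carrier_closed(2) by (simp add: multiples_def)
  }
qed (simp_all add: V_sub_closed)

lemma filtration_sum:
  "(\<And>i. i \<in> A \<Longrightarrow> P i \<in> filtration r m j) \<Longrightarrow> sum P A \<in> filtration r m j"
proof (induction A rule: infinite_finite_induct)
  case (insert x A)
  then show ?case using filtration_closed(2)[of "P x" r m j "sum P A"] by simp
qed (simp_all add: filtration_closed(1))

lemma filtration_mono: "i \<le> j \<Longrightarrow> filtration r m i \<subseteq> filtration r m j"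
proof (induction j)
  case (Suc j)
  have "filtration r m j \<subseteq> filtration r m (Suc j)"
  proof
    fix P assume "P \<in> filtration r m j"
    then show "P \<in> filtration r m (Suc j)"
      using filtration_SucI[OF _ multiples_closed(1)] by fastforce
  qed
  then show ?case using Suc by (auto simp: le_Suc_eq)
qed simp

lemma multiples_subset_filtration:
  assumes "l < (m + 1) ^ f" "(m + 1) ^ f \<le> l + j" "w \<in> multiples f r (theta_pow (digits m l))"
  shows "w \<in> filtration r m j"
proof -
  let ?i = "(m + 1) ^ f - 1 - l"
  have "(m + 1) ^ f - 1 - ?i = l" using assms(1) by simp
  then have "w \<in> filtration r m (Suc ?i)"
    using filtration_SucI[OF filtration_closed(1), of w r m ?i] assms(3) by (simp only: add_0)
  moreover have "Suc ?i \<le> j" using assms by linarith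
  ultimately show ?thesis using filtration_mono by blast
qed

text \<open>
  Every generator of the filtration step is a multiple of some \<open>\<theta>^{e'}\<close> where \<open>e'\<close> is not below \<open>e\<close>: for the generators
  \<open>\<theta>_i^{m+1}\<close> because the entries of \<open>e\<close> are at most \<open>m\<close>, for the others by assumption.
\<close>

lemma local_coeff_filtration:
  assumes "\<And>i. i < f \<Longrightarrow> e i \<le> m"
    and "\<And>l. l < j \<Longrightarrow> \<exists>i<f. e i < digits m ((m + 1) ^ f - 1 - l) i"
    and "P \<in> filtration r m j"
  shows "local_coeff e P = 0"
  using assms(2,3)
proof (induction j arbitrary: P)
  case 0
  then obtain u where u: "P = (\<Sum>i<f. u i)" "\<And>i. i < f \<Longrightarrow> u i \<in> multiples f r (theta p f i ^ (m + 1))"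
    unfolding filtration.simps V_sub_def by blast
  have "local_coeff e (u i) = 0" if i: "i < f" for i
  proof -
    obtain Q where "u i = theta p f i ^ (m + 1) * Q"
      using u(2)[OF i] unfolding multiples_def by (auto elim: dvdE)
    then have "u i = theta_pow (\<lambda>j. if j = i then m + 1 else 0) * Q"
      using theta_power_eq[OF i, of "m + 1"] by simp
    then show ?thesis using local_coeff_theta_pow_eq_0[OF i] assms(1)[OF i] by simp
  qed
  then show ?case by (simp add: u(1) local_coeff_sum)
next
  case (Suc j)
  then obtain u w where P: "P = u + w" "u \<in> filtration r m j"
    "w \<in> multiples f r (theta_pow (digits m ((m + 1) ^ f - 1 - j)))" by auto
  then obtain Q where "w = theta_pow (digits m ((m + 1) ^ f - 1 - j)) * Q"
    by (auto simp: multiples_def elim: dvdE)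
  moreover obtain i where "i < f" "e i < digits m ((m + 1) ^ f - 1 - j) i" using Suc.prems(1)[of j] by auto
  ultimately have "local_coeff e w = 0" using local_coeff_theta_pow_eq_0 by simp
  then show ?case using Suc.IH[OF _ P(2)] Suc.prems(1) by (simp add: P(1) local_coeff_add)
qed

lemma theta_pow_cong: "(\<And>i. i < f \<Longrightarrow> e i = e' i) \<Longrightarrow> theta_pow e = theta_pow e'"
  by (simp add: theta_pow_def)

lemma theta_pow_mult_carrier:
  assumes "\<And>i. i < f \<Longrightarrow> e i \<le> m" "\<And>i. i < f \<Longrightarrow> m + m * p \<le> r i"
    and P: "P \<in> V_carrier f (\<lambda>i. r i - theta_pow_degree e i)"
  shows "theta_pow e * P \<in> V_carrier f r"
proof -
  have le: "theta_pow_degree e i \<le> (if i < f then r i else 0)" for i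
    using theta_pow_degree_le[of e m i] assms(1) assms(2)[of i] by (cases "i < f") auto
  have "theta_pow e * P \<in> homogeneous (\<lambda>i. theta_pow_degree e i + (if i < f then r i - theta_pow_degree e i else 0))"
    using homogeneous_mult[OF homogeneous_theta_pow P[unfolded V_carrier_eq]] .
  also have "(\<lambda>i. theta_pow_degree e i + (if i < f then r i - theta_pow_degree e i else 0)) = (\<lambda>i. if i < f then r i else 0)"
  proof
    fix i show "theta_pow_degree e i + (if i < f then r i - theta_pow_degree e i else 0) = (if i < f then r i else 0)"
      using le[of i] by (cases "i < f") auto
  qed
  finally show ?thesis by (simp add: V_carrier_eq)
qed

lemma multiples_theta_powE:
  assumes "\<And>i. i < f \<Longrightarrow> e i \<le> m" "\<And>i. i < f \<Longrightarrow> m + m * p \<le> r i"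
    and w: "w \<in> multiples f r (theta_pow e)"
  obtains P where "P \<in> V_carrier f (\<lambda>i. r i - theta_pow_degree e i)" "w = theta_pow e * P"
proof -
  have le: "theta_pow_degree e i \<le> (if i < f then r i else 0)" for i
    using theta_pow_degree_le[of e m i] assms(1) assms(2)[of i] by (cases "i < f") auto
  obtain P where P: "w = theta_pow e * P" using w by (auto simp: multiples_def elim: dvdE)
  have "theta_pow e * P \<in> homogeneous (\<lambda>i. if i < f then r i else 0)"
    using w P by (simp add: multiples_def V_carrier_eq)
  then obtain Q where Q: "Q \<in> homogeneous (\<lambda>i. (if i < f then r i else 0) - theta_pow_degree e i)"
    "theta_pow e * P = theta_pow e * Q"
    using homogeneous_cofactor[OF homogeneous_theta_pow _ le] by blast
  have "(\<lambda>i. (if i < f then r i else 0) - theta_pow_degree e i) = (\<lambda>i. if i < f then r i - theta_pow_degree e i else 0)"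
    by auto
  then show thesis using that[of Q] Q P by (simp add: V_carrier_eq)
qed

text \<open>
  The product \<open>\<theta>^e \<theta>_i\<close> is either \<open>\<theta>^l\<close> for an exponent vector \<open>l\<close> that has been used earlier, or, if \<open>e_i = m\<close>,
  a multiple of \<open>\<theta>_i^{m+1}\<close>.
\<close>

lemma theta_pow_mult_V_sub:
  assumes r: "\<And>i. i < f \<Longrightarrow> m + m * p \<le> r i" and j: "j < (m + 1) ^ f"
  defines "e \<equiv> digits m ((m + 1) ^ f - 1 - j)"
  assumes P: "P \<in> V_sub p f (\<lambda>i. r i - theta_pow_degree e i) 1"
  shows "theta_pow e * P \<in> filtration r m j"
proof -
  let ?k = "(m + 1) ^ f - 1 - j"
  let ?s = "\<lambda>i. r i - theta_pow_degree e i"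
  obtain u where u: "P = (\<Sum>i<f. u i)" "\<And>i. i < f \<Longrightarrow> u i \<in> multiples f ?s (theta p f i ^ 1)"
    using P unfolding V_sub_def by blast
  have "theta_pow e * u i \<in> filtration r m j" if i: "i < f" for i
  proof -
    obtain Q where Q: "u i = theta p f i * Q" using u(2)[OF i] by (auto simp: multiples_def elim: dvdE)
    have c: "theta_pow e * u i \<in> V_carrier f r"
      by (rule theta_pow_mult_carrier[OF _ r]) (use u(2)[OF i] in \<open>auto simp: e_def digits_le multiples_def\<close>)
    have eq: "theta_pow e * u i = theta_pow (\<lambda>j. e j + (if j = i then 1 else 0)) * Q"
      using theta_power_eq[OF i, of 1] by (simp add: Q theta_pow_add mult.assoc)
    show ?thesis
    proof (cases "e i < m")
      case True
      then obtain l where l: "?k < l" "l < (m + 1) ^ f"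
          "\<And>j. j < f \<Longrightarrow> digits m l j = e j + (if j = i then 1 else 0)"
        using digits_Suc_at[OF i, of ?k m] j unfolding e_def by auto
      have "theta_pow (\<lambda>j. e j + (if j = i then 1 else 0)) = theta_pow (digits m l)"
        by (rule theta_pow_cong) (simp add: l(3))
      then have "theta_pow e * u i \<in> multiples f r (theta_pow (digits m l))"
        using c eq by (simp add: multiples_def)
      then show ?thesis using l(1,2) j by (intro multiples_subset_filtration[of l m j]) auto
    next
      case False
      then have ei: "e i = m" using digits_le[of m ?k i] by (simp add: e_def)
      have "theta_pow (\<lambda>j. e j + (if j = i then 1 else 0)) =
          theta_pow (\<lambda>j. (if j = i then m + 1 else 0) + (if j = i then 0 else e j))"
        by (rule theta_pow_cong) (simp add: ei)
      then have "theta p f i ^ (m + 1) dvd theta_pow e * u i"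
        unfolding eq theta_power_eq[OF i] theta_pow_add by (simp add: mult.assoc)
      then have "theta_pow e * u i \<in> V_sub p f r (m + 1)"
        using c by (intro multiples_subset_V_sub[OF i]) (simp add: multiples_def)
      then show ?thesis using filtration_mono[of 0 j r m] by auto
    qed
  qed
  then have "theta_pow e * u i \<in> filtration r m j" if "i \<in> {..<f}" for i using that by simp
  then have "(\<Sum>i<f. theta_pow e * u i) \<in> filtration r m j" by (rule filtration_sum)
  then show ?thesis by (simp add: u(1) sum_distrib_left)
qed

lemma filtration_top: "filtration r m ((m + 1) ^ f) = V_carrier f r"
proof
  show "filtration r m ((m + 1) ^ f) \<subseteq> V_carrier f r" using filtration_closed(5) by blast
  have "theta_pow (digits m 0) = 1" by (simp add: theta_pow_def digits_def)
  then have "multiples f r (theta_pow (digits m 0)) = V_carrier f r" by (simp add: multiples_def)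
  then show "V_carrier f r \<subseteq> filtration r m ((m + 1) ^ f)"
    using multiples_subset_filtration[of 0 m "(m + 1) ^ f"] by auto
qed

end

section \<open>Principal series as graded pieces\<close>

lemma induced_rep_simps:
  "carrier (induced_rep G H K chi) = {\<phi> \<in> carrier G \<rightarrow>\<^sub>E carrier K.
     \<forall>b\<in>H. \<forall>g\<in>carrier G. \<phi> (b \<otimes>\<^bsub>G\<^esub> g) = chi b \<otimes>\<^bsub>K\<^esub> \<phi> g}"
  "add (induced_rep G H K chi) = (\<lambda>\<phi> \<psi>. \<lambda>x\<in>carrier G. \<phi> x \<oplus>\<^bsub>K\<^esub> \<psi> x)"
  "module.smult (induced_rep G H K chi) = (\<lambda>c \<phi>. \<lambda>x\<in>carrier G. c \<otimes>\<^bsub>K\<^esub> \<phi> x)"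
  "rep.act (induced_rep G H K chi) = (\<lambda>g \<phi>. \<lambda>x\<in>carrier G. \<phi> (x \<otimes>\<^bsub>G\<^esub> g))"
  by (auto simp: induced_rep_def)

lemma matrix_mult_entry_2: "(A ** B) $ i $ j = A $ i $ 1 * B $ 1 $ j + A $ i $ 2 * (B :: 'k::field^2^2) $ 2 $ j"
  by (simp add: matrix_matrix_mult_def sum_2)

text \<open>
  The matrices \<open>lower_unipotent z\<close> and \<open>swap_matrix\<close> represent the right cosets of the Borel subgroup.
  A coset corresponds to the bottom row up to scaling, which is the rational point \<open>(z : 1)\<close> or \<open>(1 : 0)\<close>.
\<close>

definition lower_unipotent :: "'k::field \<Rightarrow> 'k^2^2"
  where "lower_unipotent z = vector [vector [1, 0], vector [z, 1]]"

definition swap_matrix :: "'k::field^2^2"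
  where "swap_matrix = vector [vector [0, 1], vector [1, 0]]"

lemma coset_representative_simps [simp]:
  "lower_unipotent z $ 1 $ 1 = 1" "lower_unipotent z $ 1 $ 2 = 0"
  "lower_unipotent z $ 2 $ 1 = z" "lower_unipotent z $ 2 $ 2 = 1"
  "swap_matrix $ 1 $ 1 = 0" "swap_matrix $ 1 $ 2 = 1"
  "swap_matrix $ 2 $ 1 = 1" "swap_matrix $ 2 $ 2 = 0"
  "invertible (lower_unipotent z)" "invertible swap_matrix"
  "det (lower_unipotent z) = 1" "det swap_matrix = -1"
  by (simp_all add: lower_unipotent_def swap_matrix_def invertible_2 det_2)

lemma borel_decomposition:
  fixes A :: "'k::field^2^2"
  assumes A: "invertible A"
  shows "(\<exists>B\<in>borel_subgroup. \<exists>z. A = B ** lower_unipotent z) \<or> (\<exists>B\<in>borel_subgroup. A = B ** swap_matrix)"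
proof (cases "A $ 2 $ 2 = 0")
  case True
  have "swap_matrix ** swap_matrix = (mat 1 :: 'k^2^2)"
    by (simp add: vec_eq_iff forall_2 matrix_mult_entry_2 mat_def)
  then have "A = (A ** swap_matrix) ** swap_matrix" by (simp add: matrix_mul_assoc[symmetric])
  moreover have "A ** swap_matrix \<in> borel_subgroup"
    using True A by (simp add: borel_subgroup_def invertible_mult matrix_mult_entry_2)
  ultimately show ?thesis by blast
next
  case False
  let ?z = "A $ 2 $ 1 / A $ 2 $ 2"
  have "lower_unipotent (- ?z) ** lower_unipotent ?z = (mat 1 :: 'k^2^2)"
    by (simp add: vec_eq_iff forall_2 matrix_mult_entry_2 mat_def)
  then have "A = (A ** lower_unipotent (- ?z)) ** lower_unipotent ?z" by (simp add: matrix_mul_assoc[symmetric])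
  moreover have "A ** lower_unipotent (- ?z) \<in> borel_subgroup"
    using False A by (simp add: borel_subgroup_def invertible_mult matrix_mult_entry_2)
  ultimately show ?thesis by blast
qed

lemma exists_bottom_row:
  fixes c d :: "'k::field"
  assumes "c \<noteq> 0 \<or> d \<noteq> 0"
  shows "\<exists>A::'k^2^2. invertible A \<and> A $ 2 $ 1 = c \<and> A $ 2 $ 2 = d"
proof (cases "c = 0")
  case True
  then show ?thesis using assms
    by (intro exI[of _ "vector [vector [1, 0], vector [c, d]]"]) (simp add: invertible_2)
next
  case False
  then show ?thesis
    by (intro exI[of _ "vector [vector [0, 1], vector [c, d]]"]) (simp add: invertible_2)
qed

lemma induced_rep_eqI:
  fixes \<phi> \<psi> :: "'k::field^2^2 \<Rightarrow> 'k"
  assumes \<phi>: "\<phi> \<in> carrier (induced_rep GL2 borel_subgroup ring_of_type_algebra chi)"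
    and \<psi>: "\<psi> \<in> carrier (induced_rep GL2 borel_subgroup ring_of_type_algebra chi)"
    and lower: "\<And>z. \<phi> (lower_unipotent z) = \<psi> (lower_unipotent z)" and swap: "\<phi> swap_matrix = \<psi> swap_matrix"
  shows "\<phi> = \<psi>"
proof (rule PiE_ext)
  show "\<phi> \<in> carrier GL2 \<rightarrow>\<^sub>E UNIV" "\<psi> \<in> carrier GL2 \<rightarrow>\<^sub>E UNIV"
    using \<phi> \<psi> by (simp_all add: induced_rep_simps)
  have eq: "\<phi> (B ** A) = \<psi> (B ** A)" if "B \<in> borel_subgroup" "invertible A" "\<phi> A = \<psi> A" for A B
    using \<phi> \<psi> that by (simp add: induced_rep_simps)
  fix A :: "'k^2^2" assume "A \<in> carrier GL2"
  then show "\<phi> A = \<psi> A"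
    using borel_decomposition[of A] eq lower swap by auto
qed

context finite_field_size
begin

text \<open>
  The map \<open>h\<close> sends \<open>Q\<close> to the function \<open>A \<mapsto> local_coeff e (A \<cdot> Q)\<close>, where \<open>e\<close> is the exponent vector added in
  step \<open>j\<close>. On \<open>Q = u + \<theta>^e P\<close> with \<open>u\<close> in the preceding step it is a power of \<open>det A\<close> times the value of \<open>P\<close> at
  the bottom row of \<open>A\<close>. So left multiplication of \<open>A\<close> by an upper triangular matrix acts through a
  character, surjectivity is interpolation at the rational points, and \<open>h Q = 0\<close> means that \<open>P\<close> vanishes at
  all rational points.
\<close>

lemma graded_piece:
  fixes r :: "nat \<Rightarrow> nat" and m j :: nat
  assumes r: "\<forall>i<f. m + m * q + q \<le> r i" and j: "j < (m + 1) ^ f"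
  obtains chi :: "'k^2^2 \<Rightarrow> 'k" and h :: "'k mpoly \<Rightarrow> 'k^2^2 \<Rightarrow> 'k"
  where "chi \<in> hom (GL2\<lparr>carrier := borel_subgroup\<rparr>) (mult_of ring_of_type_algebra)"
    and "h ` filtration r m (Suc j) = carrier (induced_rep GL2 borel_subgroup ring_of_type_algebra chi)"
    and "\<And>Q R. h (Q + R) = h Q \<oplus>\<^bsub>induced_rep GL2 borel_subgroup ring_of_type_algebra chi\<^esub> h R"
    and "\<And>c Q. h (Const c * Q) = c \<odot>\<^bsub>induced_rep GL2 borel_subgroup ring_of_type_algebra chi\<^esub> h Q"
    and "\<And>A Q. A \<in> carrier GL2 \<Longrightarrow>
      h (subst (frob_subst p A) Q) = rep.act (induced_rep GL2 borel_subgroup ring_of_type_algebra chi) A (h Q)"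
    and "\<And>Q R. Q \<in> filtration r m (Suc j) \<Longrightarrow> R \<in> filtration r m (Suc j) \<Longrightarrow>
      h Q = h R \<longleftrightarrow> Q - R \<in> filtration r m j"
proof -
  let ?n = "(m + 1) ^ f"
  define e where "e = digits m (?n - 1 - j)"
  define s where "s = (\<lambda>i. r i - theta_pow_degree e i)"
  define E where "E = (\<Sum>i<f. e i * p ^ i)"
  define C where "C = (\<Sum>i<f. s i * p ^ i)"
  define chi where "chi = (\<lambda>B :: 'k^2^2. det B ^ E * (B $ 2 $ 2) ^ C)"
  define h where "h = (\<lambda>Q. \<lambda>A \<in> carrier GL2. local_coeff e (subst (frob_subst p (A :: 'k^2^2)) Q))"
  define Z where "Z = induced_rep GL2 borel_subgroup ring_of_type_algebra chi"
  interpret G: Group.group "GL2 :: ('k^2^2) monoid" by (rule group_GL2)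
  have e: "e i \<le> m" for i by (simp add: e_def digits_le)
  have p_le_q: "p \<le> q" using f_pos p_gt_1 unfolding q_def by (metis less_imp_le power_increasing power_one_right)
  have r': "m + m * p \<le> r i" if "i < f" for i
    using r[rule_format, OF that] mult_le_mono2[OF p_le_q, of m] by linarith
  have s: "p \<le> s i" if "i < f" for i
  proof -
    have "theta_pow_degree e i \<le> m + m * p" using theta_pow_degree_le[of e m i] e that by simp
    then show ?thesis using r[rule_format, OF that] mult_le_mono2[OF p_le_q, of m] p_le_q unfolding s_def by linarith
  qed
  have kills: "local_coeff e u = 0" if "u \<in> filtration r m j" for u
  proof (rule local_coeff_filtration[OF e _ that])
    fix l assume "l < j"
    then show "\<exists>i<f. e i < digits m (?n - 1 - l) i"
      unfolding e_def using j by (intro digits_less_if_less) auto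
  qed
  have h_eq: "h (u + theta_pow e * P) A = det A ^ E * peval (pt (A $ 2 $ 1) (A $ 2 $ 2)) P"
    if "u \<in> filtration r m j" "invertible A" for u P A
  proof -
    have "h (u + theta_pow e * P) A = local_coeff e (subst (frob_subst p A) u)
        + local_coeff e (Const (det A ^ E) * (theta_pow e * subst (frob_subst p A) P))"
      using that by (simp add: h_def subst_add subst_mult local_coeff_add theta_pow_semi_invariant E_def mult.assoc)
    also have "local_coeff e (subst (frob_subst p A) u) = 0" by (intro kills filtration_closed that)
    finally show ?thesis by (simp add: local_coeff_Const_mult local_coeff_theta_pow peval_act)
  qed
  have decomp: "\<exists>u\<in>filtration r m j. \<exists>P\<in>V_carrier f s. Q = u + theta_pow e * P"
    if Q: "Q \<in> filtration r m (Suc j)" for Q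
  proof -
    obtain u w where "Q = u + w" "u \<in> filtration r m j" "w \<in> multiples f r (theta_pow e)"
      using Q by (auto simp: e_def)
    moreover obtain P where "P \<in> V_carrier f s" "w = theta_pow e * P"
      unfolding s_def by (rule multiples_theta_powE[where r = r, OF e r' calculation(3)])
    ultimately show ?thesis by blast
  qed
  have comp: "u + theta_pow e * P \<in> filtration r m (Suc j)" if "u \<in> filtration r m j" "P \<in> V_carrier f s" for u P
  proof (rule filtration_SucI[OF that(1)])
    show "theta_pow e * P \<in> multiples f r (theta_pow (digits m (?n - 1 - j)))"
      using theta_pow_mult_carrier[of e m r P, OF e r'] that(2)
      unfolding e_def[symmetric] multiples_def s_def by simp
  qed
  have chi_hom: "chi \<in> hom (GL2\<lparr>carrier := borel_subgroup\<rparr>) (mult_of ring_of_type_algebra)"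
  proof (rule homI)
    fix A :: "'k^2^2" assume A: "A \<in> carrier (GL2\<lparr>carrier := borel_subgroup\<rparr>)"
    then have "A $ 2 $ 2 \<noteq> 0" "det A \<noteq> 0" by (auto simp: borel_subgroup_def invertible_2 det_2)
    then show "chi A \<in> carrier (mult_of ring_of_type_algebra)" by (simp add: chi_def)
  next
    fix A B :: "'k^2^2"
    assume "A \<in> carrier (GL2\<lparr>carrier := borel_subgroup\<rparr>)" "B \<in> carrier (GL2\<lparr>carrier := borel_subgroup\<rparr>)"
    then show "chi (A \<otimes>\<^bsub>GL2\<lparr>carrier := borel_subgroup\<rparr>\<^esub> B) = chi A \<otimes>\<^bsub>mult_of ring_of_type_algebra\<^esub> chi B"
      by (simp add: borel_subgroup_def chi_def det_mul matrix_mult_entry_2 power_mult_distrib mult_ac)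
  qed
  have h_carrier: "h Q \<in> carrier Z" if Q: "Q \<in> filtration r m (Suc j)" for Q
  proof -
    obtain u P where QP: "Q = u + theta_pow e * P" "u \<in> filtration r m j" "P \<in> V_carrier f s"
      using decomp[OF Q] by blast
    have "h Q (B ** A) = chi B * h Q A" if B: "B \<in> borel_subgroup" and A: "invertible A" for A B :: "'k^2^2"
    proof -
      have "B $ 2 $ 1 = 0" "invertible B" using B by (simp_all add: borel_subgroup_def)
      moreover from this have "h Q (B ** A) = det (B ** A) ^ E * peval (pt ((B ** A) $ 2 $ 1) ((B ** A) $ 2 $ 2)) P"
        unfolding QP(1) by (intro h_eq QP A invertible_mult)
      moreover have "h Q A = det A ^ E * peval (pt (A $ 2 $ 1) (A $ 2 $ 2)) P"
        unfolding QP(1) by (intro h_eq QP A)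
      ultimately show ?thesis
        using peval_pt_scale[OF QP(3), of "B $ 2 $ 2" "A $ 2 $ 1" "A $ 2 $ 2"]
        by (simp add: matrix_mult_entry_2 det_mul chi_def power_mult_distrib C_def)
    qed
    moreover have "h Q \<in> carrier GL2 \<rightarrow>\<^sub>E UNIV" by (simp add: h_def)
    ultimately show ?thesis by (simp add: Z_def induced_rep_simps)
  qed
  have h_onto: "h ` filtration r m (Suc j) = carrier Z"
  proof (intro equalityI subsetI)
    fix \<phi> assume "\<phi> \<in> h ` filtration r m (Suc j)" then show "\<phi> \<in> carrier Z" using h_carrier by auto
  next
    fix \<phi> assume \<phi>: "\<phi> \<in> carrier Z"
    \<comment> \<open>The sign compensates \<open>det swap_matrix = -1\<close>.\<close>
    obtain P where P: "P \<in> V_carrier f s" "\<And>z. peval (pt z 1) P = \<phi> (lower_unipotent z)"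
        "peval (pt 1 0) P = \<phi> swap_matrix * (-1) ^ E"
      using interpolation[where s = s and v = "\<lambda>z. \<phi> (lower_unipotent z)" and w = "\<phi> swap_matrix * (-1) ^ E", OF s]
      by blast
    let ?Q = "0 + theta_pow e * P"
    have Q: "?Q \<in> filtration r m (Suc j)" by (intro comp filtration_closed P)
    have "\<phi> = h ?Q"
    proof (rule induced_rep_eqI)
      show "\<phi> \<in> carrier (induced_rep GL2 borel_subgroup ring_of_type_algebra chi)"
        and "h ?Q \<in> carrier (induced_rep GL2 borel_subgroup ring_of_type_algebra chi)"
        using \<phi> h_carrier[OF Q] by (simp_all add: Z_def)
      show "\<phi> (lower_unipotent z) = h ?Q (lower_unipotent z)" for z
        by (subst h_eq) (simp_all add: filtration_closed P)
      have "((-1) ^ E * (-1) ^ E :: 'k) = 1" by (simp flip: power_mult_distrib)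
      then show "\<phi> swap_matrix = h ?Q swap_matrix"
        by (subst h_eq) (simp_all add: filtration_closed P)
    qed
    then show "\<phi> \<in> h ` filtration r m (Suc j)" using Q by blast
  qed
  have h_add: "h (Q + R) = h Q \<oplus>\<^bsub>Z\<^esub> h R" for Q R
    by (auto simp: Z_def induced_rep_simps h_def subst_add local_coeff_add restrict_def)
  have h_smult: "h (Const c * Q) = c \<odot>\<^bsub>Z\<^esub> h Q" for c Q
    by (auto simp: Z_def induced_rep_simps h_def subst_mult local_coeff_Const_mult restrict_def)
  have h_act: "h (subst (frob_subst p A) Q) = rep.act Z A (h Q)" if "A \<in> carrier GL2" for A Q
    using that by (auto simp: Z_def induced_rep_simps h_def subst_subst frob_subst_mult restrict_def invertible_mult)
  have h_fibre: "h Q = h R \<longleftrightarrow> Q - R \<in> filtration r m j"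
    if Q: "Q \<in> filtration r m (Suc j)" and R: "R \<in> filtration r m (Suc j)" for Q R
  proof -
    have "h Q A = h (Q - R) A + h R A" if "invertible A" for A
      using h_add[of "Q - R" R] that by (simp add: Z_def induced_rep_simps)
    then have eq: "h Q = h R \<longleftrightarrow> (\<forall>A. invertible A \<longrightarrow> h (Q - R) A = 0)"
      by (auto simp: h_def restrict_def fun_eq_iff)
    have "Q + Const (-1) * R \<in> filtration r m (Suc j)"
      by (intro filtration_closed(2,3) Q R)
    moreover have "Q + Const (-1) * R = Q - R"
      using Const_diff[of "0::'k" 1] by simp
    ultimately have D: "Q - R \<in> filtration r m (Suc j)" by simp
    show ?thesis
    proof
      assume "h Q = h R"
      obtain u P where uP: "Q - R = u + theta_pow e * P" "u \<in> filtration r m j" "P \<in> V_carrier f s"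
        using decomp[OF D] by blast
      have "peval (pt c d) P = 0" if cd: "c \<noteq> 0 \<or> d \<noteq> 0" for c d :: 'k
      proof -
        obtain A :: "'k^2^2" where A: "invertible A" "A $ 2 $ 1 = c" "A $ 2 $ 2 = d"
          using exists_bottom_row[OF cd] by blast
        then have "det A \<noteq> 0" by (simp add: invertible_det_nz)
        moreover have "h (Q - R) A = 0" using eq \<open>h Q = h R\<close> A(1) by blast
        ultimately show ?thesis using h_eq[OF uP(2) A(1), of P] uP(1) A by simp
      qed
      then have "P \<in> V_sub p f s 1" using s uP(3) vanishing_imp_V_sub by blast
      then have "theta_pow e * P \<in> filtration r m j"
        using theta_pow_mult_V_sub[where r = r, OF r' j] by (simp add: s_def e_def)
      then show "Q - R \<in> filtration r m j" using uP filtration_closed(2) by metis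
    next
      assume "Q - R \<in> filtration r m j"
      then have "h (Q - R) A = 0" if "invertible A" for A
        using h_eq[OF _ that, of "Q - R" 0] by simp
      then show "h Q = h R" using eq by blast
    qed
  qed
  show thesis
    by (rule that[of chi h])
      (use chi_hom h_onto h_add h_smult h_act h_fibre in \<open>simp_all only: Z_def\<close>)
qed

lemma subrepresentation_filtration:
  "subrepresentation GL2 ring_of_type_algebra (V_rep p f r :: ('k, 'k mpoly, 'k^2^2) rep) (filtration r m j)"
proof -
  interpret V: representation GL2 ring_of_type_algebra "V_rep p f r :: ('k, 'k mpoly, 'k^2^2) rep"
    by (rule representation_V)
  show ?thesis
    by (rule V.subrepresentationI) (auto simp: filtration_closed)
qed

end

theorem theorem3p4:
  fixes p f q m :: nat
    and r :: "nat \<Rightarrow> nat"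
  assumes "prime p"
    and "f \<ge> 1"
    and "q = p ^ f"
    and "CARD('k::{field,finite}) = q"
    and "\<And>i. i < f \<Longrightarrow> r i \<ge> m + m * q + q"
  shows "decomposable_into_principal_series
    (quotient_rep (V_rep p f r :: ('k, 'k mpoly, 'k ^ 2 ^ 2) rep) (V_sub p f r (m + 1)))"
proof -
  interpret finite_field_size p f q "TYPE('k)"
    by unfold_locales (use assms in auto)
  let ?V = "V_rep p f r :: ('k, 'k mpoly, 'k^2^2) rep"
  interpret V: representation GL2 ring_of_type_algebra ?V
    by (rule representation_V)
  let ?W = "V_sub p f r (m + 1) :: 'k mpoly set"
  have r_all: "\<forall>i<f. m + m * q + q \<le> r i" using assms(5) by blast
  let ?n = "(m + 1) ^ f"
  let ?\<pi> = "\<lambda>v. ?W +>\<^bsub>?V\<^esub> v"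
  define F where "F = (\<lambda>j. ?\<pi> ` filtration r m j)"
  have W: "?W = filtration r m 0" by simp
  note sub = subrepresentation_filtration[of r m]
  have subW: "subrepresentation GL2 ring_of_type_algebra ?V ?W"
    unfolding W by (rule sub)
  interpret S: abelian_subgroup ?W ?V by (rule V.subrep_abelian_subgroup[OF subW])
  interpret Q: representation GL2 ring_of_type_algebra "quotient_rep ?V ?W"
    by (rule V.representation_quotient[OF subW])
  have "F 0 = {\<zero>\<^bsub>quotient_rep ?V ?W\<^esub>}"
  proof -
    have "?\<pi> u = ?W" if "u \<in> ?W" for u
      by (rule V.a_coset_join2) (use that S.a_subset S.a_subgroup in auto)
    moreover have "?W \<noteq> {}" using V_sub_closed(1) by blast
    ultimately have "?\<pi> ` ?W = {?W}" by blast
    then show ?thesis by (simp only: F_def filtration.simps quotient_rep_simps)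
  qed
  moreover have "F ?n = carrier (quotient_rep ?V ?W)"
    by (simp only: F_def filtration_top quotient_rep_simps V_rep_simps)
  moreover have "subrepresentation GL2 ring_of_type_algebra (quotient_rep ?V ?W) (F j)" for j
    unfolding F_def by (rule V.subrep_quotient_image[OF subW sub])
  moreover have "F j \<subseteq> F (Suc j)" for j
    unfolding F_def by (rule image_mono) (rule filtration_mono, simp)
  moreover have "principal_series (quotient_rep ((quotient_rep ?V ?W)\<lparr>carrier := F (Suc j)\<rparr>) (F j))"
    if j: "j < ?n" for j
  proof -
    obtain chi :: "'k^2^2 \<Rightarrow> 'k" and h :: "'k mpoly \<Rightarrow> 'k^2^2 \<Rightarrow> 'k" where
      chi: "chi \<in> hom (GL2\<lparr>carrier := borel_subgroup\<rparr>) (mult_of ring_of_type_algebra)"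
      and onto: "h ` filtration r m (Suc j) = carrier (induced_rep GL2 borel_subgroup ring_of_type_algebra chi)"
      and hom: "\<And>Q R. h (Q + R) = h Q \<oplus>\<^bsub>induced_rep GL2 borel_subgroup ring_of_type_algebra chi\<^esub> h R"
        "\<And>c Q. h (Const c * Q) = c \<odot>\<^bsub>induced_rep GL2 borel_subgroup ring_of_type_algebra chi\<^esub> h Q"
        "\<And>A Q. A \<in> carrier GL2 \<Longrightarrow>
          h (subst (frob_subst p A) Q) = rep.act (induced_rep GL2 borel_subgroup ring_of_type_algebra chi) A (h Q)"
      and fibre: "\<And>Q R. Q \<in> filtration r m (Suc j) \<Longrightarrow> R \<in> filtration r m (Suc j) \<Longrightarrow>
          h Q = h R \<longleftrightarrow> Q - R \<in> filtration r m j"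
      by (rule graded_piece[OF r_all j], rule that)
    have coset: "Q - R \<in> filtration r m j \<longleftrightarrow> Q \<in> filtration r m j +>\<^bsub>?V\<^esub> R" for Q R
    proof
      assume "Q - R \<in> filtration r m j"
      then show "Q \<in> filtration r m j +>\<^bsub>?V\<^esub> R"
        by (auto simp: a_r_coset_iff intro!: bexI[of _ "Q - R"])
    qed (auto simp: a_r_coset_iff)
    have WA: "?W \<subseteq> filtration r m j" using filtration_mono[of 0 j r m] by simp
    have AB: "filtration r m j \<subseteq> filtration r m (Suc j)" by (rule filtration_mono) simp
    note iso = V.subquotient_rep_isomorphic[where h = h and A = "filtration r m j" and B = "filtration r m (Suc j)",
        OF subW sub sub WA AB onto]
    show ?thesis
      unfolding principal_series_def F_def
      by (intro conjI bexI[OF _ chi] iso refl)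
        (simp_all only: V_rep_simps ring_of_type_algebra_simps hom fibre coset)
  qed
  ultimately show ?thesis
    unfolding decomposable_into_principal_series_def
    using Q.representation_axioms by (intro conjI exI[of _ ?n] exI[of _ F]) auto
qed

end
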